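(* Let $p\in\mathbb{N}$ and let $G=(V,E)$ be an undirected graph with vertex set $V=\{1,\ldots,p\}$. With the map $h_G:\mathscr{S}^+_p\to\mathscr{S}^+_p$ and the matrices $M_p$ and $Q_D$ defined in the context: (I) The function $h_G$ is continuously differentiable on $\mathscr{S}^+_p$. (II) The derivative of $h_G$ at $A\in\mathscr{S}^+_p$ is $$\mathds{D}h_G(A) = M_p - M_pQ_D^T\left\{Q_DM_p(A_G^{-1}\otimes A_G^{-1})Q_D^T\right\}^{-1}Q_D(A_G^{-1}\otimes A_G^{-1})M_p,$$ where $A_G$ denotes $h_G(A)$.
   Context: Matrix sets: $\mathscr{S}_p$ is the set of symmetric real $p\times p$ matrices and $\mathscr{S}^+_p$ the set of symmetric positive definite ones. Graphs are undirected without loops; edges are sets $\{i,j\}$ with $i\ne j$. The map $h_G$: for $A\in\mathscr{S}^+_p$, $A_G=h_G(A)$ is the unique matrix in $\mathscr{S}^+_p$ satisfying $(A_G)_{i,j}=A_{i,j}$ if $\{i,j\}\in E$ or $i=j$, and $(A_G^{-1})_{i,j}=0$ if $\{i,j\}\notin E$ and $i\neq j$. (Existence and uniqueness of this matrix are known.) Matrix notation: $\otimes$ is the Kronecker product; $\mathrm{vec}\,A\in\mathbb{R}^{p^2}$ stacks the columns of $A\in\mathbb{R}^{p\times p}$ from left to right underneath each other. $e_1,\dots,e_p$ are the unit vectors in $\mathbb{R}^p$, $K_p=\sum_{i,j=1}^p e_ie_j^T\otimes e_je_i^T$ and $M_p=\frac12(I_{p^2}+K_p)$. Let $m=p(p+1)/2$.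 For $A\in\mathscr{S}_p$, $v(A)\in\mathbb{R}^m$ is obtained from $\mathrm{vec}\,A$ by deleting the super-diagonal elements of $A$; $D_p\in\mathbb{R}^{p^2\times m}$ (duplication matrix) is the matrix with $D_pv(A)=\mathrm{vec}\,A$ for all $A\in\mathscr{S}_p$, and $D_p^+=(D_p^TD_p)^{-1}D_p^T$. Selection matrices: for a set $Z=\{z_1,\dots,z_r\}$ of matrix positions $z_k=(i_k,j_k)\in\{1,\dots,p\}^2$, listed in the order in which these positions appear in $\mathrm{vec}$ (column by column), $Q_Z\in\mathbb{R}^{r\times p^2}$ is the matrix whose $k$-th row has entry $1$ in column $(j_k-1)p+i_k$ and zeros otherwise. Let $D(G)=\{(i,j): 1\le j<i\le p,\ \{i,j\}\notin E\}$ and $Q_D=Q_{D(G)}$. If $D(G)$ is empty, $Q_D$ has no rows and the term containing it is zero. Differentiability: for $h:\mathscr{C}\subseteq\mathscr{S}_p\to\mathscr{S}_p$ let $\tilde{\mathscr{C}}=v(\mathscr{C})\subseteq\mathbb{R}^m$ and let $\tilde h:\tilde{\mathscr{C}}\to\mathbb{R}^m$ be the function mapping $v(A)$ to $v(h(A))$. The function $h$ is called continuously differentiable on $\mathscr{C}$ if $\tilde{\mathscr{C}}$ is open in $\mathbb{R}^m$ and $\tilde h$ is continuously differentiable; its derivative at $A\in\mathscr{C}$ is the $p^2\times p^2$ matrix $\mathds{D}h(A)=D_p\,\mathds{D}\tilde h(v(A))\,D_p^+$, where $\mathds{D}\tilde h(x)$ is the Jacobi matrix of $\tilde h$ at $x$.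 *)

theory Defs
  imports "HOL-Analysis.Analysis" "Jordan_Normal_Form.Gauss_Jordan_Elimination"
begin

text \<open>
  The vertex set \<open>{1,...,p}\<close> is an arbitrary finite linearly ordered type \<open>'p\<close>, so that
  \<open>p = CARD('p)\<close>; \<open>i\<close> stands for the vertex with number \<open>card {k. k < i} + 1\<close>.

  Matrices and vectors whose size depends on \<open>p\<close> only are those of \<open>HOL-Analysis\<close>. The space of
  dimension \<open>p\<^sup>2\<close> is indexed by \<open>'p \<times> 'p\<close>: the index \<open>(i, j)\<close> is the place that the entry in
  row \<open>i\<close> and column \<open>j\<close> of a \<open>p \<times> p\<close> matrix takes in its column-wise vectorisation. The number
  of rows of \<open>Q\<^sub>D\<close> depends on the graph and may be 0, so \<open>Q\<^sub>D\<close> is a matrix of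
  \<open>Jordan_Normal_Form\<close>; \<open>flat_mat\<close> below passes from the former matrices to the latter.
\<close>

type_synonym 'p sq_mat = "((real, 'p) Finite_Cartesian_Product.vec, 'p) Finite_Cartesian_Product.vec"

no_notation Matrix.vec_index (infixl "$" 100)

definition sym_mats :: "('p::finite) sq_mat set" where
  "sym_mats = {A. transpose A = A}"

definition posdef_mats :: "('p::finite) sq_mat set" where
  "posdef_mats = {A \<in> sym_mats. \<forall>x. x \<noteq> 0 \<longrightarrow> x \<bullet> (A *v x) > 0}"

definition h_G :: "'p::finite set set \<Rightarrow> 'p sq_mat \<Rightarrow> 'p sq_mat" where
  "h_G E A = (THE B. B \<in> posdef_mats \<and>
     (\<forall>i j. {i, j} \<in> E \<or> i = j \<longrightarrow> B $ i $ j = A $ i $ j) \<and>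
     (\<forall>i j. {i, j} \<notin> E \<and> i \<noteq> j \<longrightarrow> matrix_inv B $ i $ j = 0))"


subsection \<open>Vectorisation and matrices of size \<open>p\<^sup>2\<close>\<close>

definition vec_of :: "('p::finite) sq_mat \<Rightarrow> real^('p \<times> 'p)" where
  "vec_of A = vec_lambda (\<lambda>(i, j). A $ i $ j)"

text \<open>
  Index set of \<open>v(A)\<close>, i.e. of the coordinates of \<open>\<real>\<^sup>m\<close>, \<open>m = p (p + 1) / 2\<close>: the positions
  \<open>(i, j)\<close> on and below the diagonal.
\<close>

typedef (overloaded) ('p::linorder) lowtri = "{(i::'p, j). j \<le> i}"
  by auto

instance lowtri :: ("{finite, linorder}") finite
proof
  have "inj (Rep_lowtri :: 'a lowtri \<Rightarrow> _)"
    by (simp add: inj_on_def Rep_lowtri_inject)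
  then show "finite (UNIV :: 'a lowtri set)"
    by (rule finite_imageD[rotated]) simp
qed

definition v_of :: "('p::{finite,linorder}) sq_mat \<Rightarrow> real^'p lowtri" where
  "v_of A = (\<chi> k. vec_of A $ Rep_lowtri k)"

definition dup_mat :: "real^('p lowtri)^('p::{finite,linorder} \<times> 'p)" where
  "dup_mat = (THE D. \<forall>A \<in> sym_mats. D *v v_of A = vec_of A)"

definition dup_mat_pinv :: "real^('p \<times> 'p)^('p::{finite,linorder} lowtri)" where
  "dup_mat_pinv = matrix_inv (transpose dup_mat ** dup_mat) ** transpose dup_mat"

text \<open>
  In \<open>A \<otimes> B\<close> the outer (block) index comes from \<open>A\<close> and the inner one from \<open>B\<close>. Row \<open>k\<close> of
  block row \<open>a\<close> has number \<open>(a - 1) p + k\<close>, which is the place of the matrix position \<open>(k, a)\<close>.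
\<close>

definition kron :: "('p::finite) sq_mat \<Rightarrow> 'p sq_mat \<Rightarrow> ('p \<times> 'p) sq_mat" where
  "kron A B = vec_lambda (\<lambda>(k, a). vec_lambda (\<lambda>(l, b). A $ a $ b * B $ k $ l))"

definition unit_mat :: "'p::finite \<Rightarrow> 'p \<Rightarrow> 'p sq_mat" where  \<comment> \<open>\<open>e\<^sub>i e\<^sub>j\<^sup>T\<close>\<close>
  "unit_mat i j = (columnvector (axis i 1) :: real^1^'p) ** (rowvector (axis j 1) :: real^'p^1)"

definition K_mat :: "('p::finite \<times> 'p) sq_mat" where
  "K_mat = (\<Sum>i\<in>UNIV. \<Sum>j\<in>UNIV. kron (unit_mat i j) (unit_mat j i))"

definition M_mat :: "('p::finite \<times> 'p) sq_mat" where
  "M_mat = (1 / 2) *\<^sub>R (Finite_Cartesian_Product.mat 1 + K_mat)"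


subsection \<open>Differentiability of maps between symmetric matrices\<close>

text \<open>
  The function \<open>v(A) \<mapsto> v(h(A))\<close> on \<open>v(C)\<close>; it is well defined since \<open>v_of\<close> is injective on
  \<open>sym_mats\<close>. Outside \<open>v(C)\<close> its values are irrelevant, because \<open>v(C)\<close> is required to be open.
\<close>

definition half_vec_map ::
    "('p::{finite,linorder}) sq_mat set \<Rightarrow> ('p sq_mat \<Rightarrow> 'p sq_mat) \<Rightarrow>
     real^'p lowtri \<Rightarrow> real^'p lowtri" where
  "half_vec_map C h x = v_of (h (inv_into C v_of x))"

definition cont_differentiable_on ::
    "('p sq_mat \<Rightarrow> 'p sq_mat) \<Rightarrow> ('p::{finite,linorder}) sq_mat set \<Rightarrow> bool" where
  "cont_differentiable_on h C \<longleftrightarrow>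
     C \<subseteq> sym_mats \<and> h ` C \<subseteq> sym_mats \<and> open (v_of ` C) \<and>
     (\<forall>x \<in> v_of ` C. half_vec_map C h differentiable (at x)) \<and>
     continuous_on (v_of ` C) (\<lambda>x. jacobian (half_vec_map C h) (at x))"

definition matrix_deriv ::
    "('p::{finite,linorder}) sq_mat set \<Rightarrow> ('p sq_mat \<Rightarrow> 'p sq_mat) \<Rightarrow> 'p sq_mat \<Rightarrow>
     ('p \<times> 'p) sq_mat" where
  "matrix_deriv C h A =
     dup_mat ** jacobian (half_vec_map C h) (at (v_of A)) ** dup_mat_pinv"


subsection \<open>Selection matrices\<close>

text \<open>
  The entry in row \<open>i\<close> and column \<open>j\<close> has number \<open>(j - 1) p + i\<close> in the vectorisation; numbers
  start from 0 here, as do the indices of matrices in \<open>Jordan_Normal_Form\<close>.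
\<close>

definition vec_pos :: "'p::{finite,linorder} \<times> 'p \<Rightarrow> nat" where
  "vec_pos = (\<lambda>(i, j). card {k. k < j} * CARD('p) + card {k. k < i})"

definition flat_mat :: "('p::{finite,linorder} \<times> 'p) sq_mat \<Rightarrow> real mat" where
  "flat_mat X = Matrix.mat (CARD('p)\<^sup>2) (CARD('p)\<^sup>2) (\<lambda>(k, l). X $ inv_into UNIV vec_pos k $ inv_into UNIV vec_pos l)"

definition Q_mat :: "('p::{finite,linorder} \<times> 'p) set \<Rightarrow> real mat" where
  "Q_mat Z = Matrix.mat (card Z) (CARD('p)\<^sup>2)
     (\<lambda>(k, l). if l = sorted_list_of_set (vec_pos ` Z) ! k then 1 else 0)"

definition D_set :: "'p::linorder set set \<Rightarrow> ('p \<times> 'p) set" where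
  "D_set E = {(i, j). j < i \<and> {i, j} \<notin> E}"

definition Q_D :: "'p::{finite,linorder} set set \<Rightarrow> real mat" where
  "Q_D E = Q_mat (D_set E)"

end

theory Submission
  imports Defs
begin

text \<open>
  The completion \<open>A\<^sub>G\<close> maximises the determinant among the positive semidefinite matrices that agree
  with \<open>A\<close> on the edges and the diagonal; it is unique because
  \<open>tr (H\<^sup>T P H Q) > 0\<close> for positive definite \<open>P\<close>, \<open>Q\<close> and \<open>H \<noteq> 0\<close>. Send a positive definite \<open>B\<close> to its
  entries at the edges and the diagonal together with the entries of \<open>B\<inverse>\<close> at the non-edges. By the same
  trace inequality this map has invertible derivative, so the inverse function theorem shows that
  \<open>A \<mapsto> A\<^sub>G\<close>, which is a local inverse of it composed with the projection onto the edge coordinates,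
  is continuously differentiable.

  Let \<open>F\<close> be the derivative and \<open>W = A\<^sub>G\<inverse> \<otimes> A\<^sub>G\<inverse>\<close>. Since \<open>A\<^sub>G - A\<close> vanishes on the edges,
  \<open>M - F = M Q\<^sup>T Y\<close> for some \<open>Y\<close>; since \<open>A\<^sub>G\<inverse>\<close> vanishes on the non-edges, \<open>Q W F = 0\<close>. As \<open>M\<close> and \<open>W\<close>
  commute, \<open>(Q M W Q\<^sup>T) Y = Q W M\<close>, which determines \<open>Y\<close>.
\<close>

subsection \<open>Positive definite matrices\<close>

no_notation Matrix.scalar_prod (infix "\<bullet>" 70)

lemma matrix_inv_right_left:
  fixes A :: "real^'n^'n"
  assumes "invertible A"
  shows "A ** matrix_inv A = Finite_Cartesian_Product.mat 1"
    and "matrix_inv A ** A = Finite_Cartesian_Product.mat 1"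
proof -
  have "A ** matrix_inv A = Finite_Cartesian_Product.mat 1 \<and>
      matrix_inv A ** A = Finite_Cartesian_Product.mat 1"
    using assms unfolding invertible_def matrix_inv_def by (rule someI_ex)
  then show "A ** matrix_inv A = Finite_Cartesian_Product.mat 1"
    "matrix_inv A ** A = Finite_Cartesian_Product.mat 1" by auto
qed

lemma invertible_if_ker_trivial:
  fixes A :: "real^'n^'n"
  assumes "\<And>x. A *v x = 0 \<Longrightarrow> x = 0"
  shows "invertible A"
  using assms invertible_left_inverse matrix_left_invertible_ker by blast

lemma inner_matrix_vector_mult_transpose:
  fixes A :: "real^'n^'m"
  shows "x \<bullet> (A *v y) = (transpose A *v x) \<bullet> y"
  by (metis dot_lmul_matrix transpose_matrix_vector)

lemma posdef_invertible: "invertible A" if "A \<in> posdef_mats"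
proof (rule invertible_if_ker_trivial)
  fix x assume "A *v x = 0"
  then have "x \<bullet> (A *v x) = 0" by simp
  moreover have "x \<noteq> 0 \<Longrightarrow> x \<bullet> (A *v x) > 0"
    using that by (simp add: posdef_mats_def)
  ultimately show "x = 0" by (metis less_irrefl)
qed

lemma posdef_transpose: "transpose A = A" if "A \<in> posdef_mats"
  using that by (simp add: posdef_mats_def sym_mats_def)

lemma posdef_matrix_inv: "matrix_inv A \<in> posdef_mats" if A: "A \<in> posdef_mats"
proof -
  note inv = matrix_inv_right_left[OF posdef_invertible[OF A]]
  have "transpose (matrix_inv A) ** A = Finite_Cartesian_Product.mat 1"
    using arg_cong[OF inv(1), of transpose]
    by (simp add: matrix_transpose_mul posdef_transpose[OF A])
  then have sym: "transpose (matrix_inv A) = matrix_inv A"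
    by (metis inv(1) matrix_mul_assoc matrix_mul_lid matrix_mul_rid)
  have "x \<bullet> (matrix_inv A *v x) > 0" if "x \<noteq> 0" for x
  proof -
    let ?y = "matrix_inv A *v x"
    have x: "A *v ?y = x"
      by (simp add: matrix_vector_mul_assoc inv)
    with that have "?y \<noteq> 0" by auto
    then have "?y \<bullet> (A *v ?y) > 0"
      using A by (simp add: posdef_mats_def)
    then show ?thesis by (simp add: x inner_commute)
  qed
  with sym show ?thesis by (simp add: posdef_mats_def sym_mats_def)
qed

section \<open>Positive semidefinite matrices, sums of squares and the trace inequality\<close>

definition psd_mats :: "('p::finite) sq_mat set" where
  "psd_mats = {A \<in> sym_mats. \<forall>x. x \<bullet> (A *v x) \<ge> 0}"

lemma posdef_imp_psd: "A \<in> posdef_mats \<Longrightarrow> A \<in> psd_mats"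
  unfolding posdef_mats_def psd_mats_def
  by (simp add: le_less) (metis inner_zero_left)

lemma sym_mats_nth: "A \<in> sym_mats \<longleftrightarrow> (\<forall>i j. A $ i $ j = A $ j $ i)"
  by (auto simp: sym_mats_def transpose_def Finite_Cartesian_Product.vec_eq_iff)

text \<open>If \<open>A *v x\<close> were nonzero, a small step from \<open>x\<close> against it
  would make the quadratic form negative: the linear term of the form beats the quadratic
  one.\<close>

lemma psd_isotropic_imp_kernel:
  assumes A: "A \<in> psd_mats" and x: "x \<bullet> (A *v x) = 0"
  shows "A *v x = 0"
proof (rule ccontr)
  let ?y = "A *v x"
  assume "?y \<noteq> 0"
  then have n: "?y \<bullet> ?y > 0" by simp
  define c where "c = ?y \<bullet> (A *v ?y)"
  have c: "c \<ge> 0" using A by (simp add: c_def psd_mats_def)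
  \<comment> \<open>The \<open>+ 1\<close> keeps the denominator positive when \<open>c = 0\<close>,
    and \<open>s * c\<close> still stays below \<open>?y \<bullet> ?y\<close>.\<close>
  define s where "s = (?y \<bullet> ?y) / (c + 1)"
  have s: "s > 0" using n c by (simp add: s_def)
  have yx: "x \<bullet> (A *v ?y) = ?y \<bullet> ?y"
    using A by (subst inner_matrix_vector_mult_transpose) (simp add: psd_mats_def sym_mats_def)
  have "0 \<le> (x - s *\<^sub>R ?y) \<bullet> (A *v (x - s *\<^sub>R ?y))"
    using A by (simp add: psd_mats_def)
  also have "\<dots> = s * (s * c - 2 * (?y \<bullet> ?y))"
    by (simp add: matrix_vector_mult_diff_distrib matrix_vector_mult_scaleR inner_diff_left
        inner_diff_right x yx c_def algebra_simps inner_commute)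
  finally have "0 \<le> s * c - 2 * (?y \<bullet> ?y)"
    using s by (simp add: zero_le_mult_iff)
  moreover have "s * c \<le> ?y \<bullet> ?y"
    using n c by (simp add: s_def divide_simps mult_left_mono)
  ultimately show False using n by linarith
qed

lemma psd_invertible_imp_posdef:
  assumes A: "A \<in> psd_mats" and "invertible A"
  shows "A \<in> posdef_mats"
proof -
  have "x \<bullet> (A *v x) > 0" if "x \<noteq> 0" for x
  proof (rule ccontr)
    assume "\<not> x \<bullet> (A *v x) > 0"
    moreover have "x \<bullet> (A *v x) \<ge> 0" using A by (simp add: psd_mats_def)
    ultimately have "A *v x = 0"
      using psd_isotropic_imp_kernel[OF A] by force
    then show False
      using that assms(2) by (metis inj_matrix_vector_mult injD matrix_vector_mult_0_right)
  qed
  then show ?thesis using A by (simp add: psd_mats_def posdef_mats_def)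
qed

lemma quadratic_form_expand: "x \<bullet> (A *v y) = (\<Sum>i\<in>UNIV. \<Sum>j\<in>UNIV. x $ i * A $ i $ j * y $ j)"
  for A :: "real^'n^'m"
  by (simp add: inner_vec_def matrix_vector_mult_def sum_distrib_left mult.assoc)

lemma psd_diag_nonneg: "A $ i $ i \<ge> 0" if "A \<in> psd_mats"
proof -
  have "axis i 1 \<bullet> (A *v axis i 1) \<ge> 0" using that by (simp add: psd_mats_def)
  then show ?thesis
    by (simp add: matrix_vector_mult_basis inner_axis' column_def)
qed

lemma psd_diag_zero_imp_row_zero: "A $ i $ j = 0" if "A \<in> psd_mats" "A $ i $ i = 0"
proof -
  have "A *v axis i 1 = 0"
    using that by (intro psd_isotropic_imp_kernel)
      (simp_all add: matrix_vector_mult_basis inner_axis' column_def)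
  then have "A $ j $ i = 0"
    by (metis column_def matrix_vector_mult_basis vec_lambda_beta zero_index)
  then show ?thesis using that by (simp add: psd_mats_def sym_mats_nth)
qed

text \<open>Induction on the support of \<open>A\<close>; the step is one step of symmetric Gaussian elimination.\<close>

lemma psd_sum_of_squares:
  fixes A :: "'p::finite sq_mat"
  assumes "finite S" "A \<in> psd_mats" "\<And>i j. i \<notin> S \<Longrightarrow> A $ i $ j = 0"
  shows "\<exists>v::'p \<Rightarrow> real^'p. \<forall>i j. A $ i $ j = (\<Sum>k\<in>S. v k $ i * v k $ j)"
  using assms
proof (induction S arbitrary: A rule: finite_induct)
  case empty
  then show ?case by simp
next
  case (insert k S)
  show ?case
  proof (cases "A $ k $ k = 0")
    case True
    have "A $ i $ j = 0" if "i \<notin> S" for i j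
      using psd_diag_zero_imp_row_zero[OF insert.prems(1) True] insert.prems(2) that
      by (cases "i = k") auto
    from insert.IH[OF insert.prems(1) this] obtain v :: "'p \<Rightarrow> real^'p"
      where "\<forall>i j. A $ i $ j = (\<Sum>k\<in>S. v k $ i * v k $ j)" by blast
    then show ?thesis
      using insert.hyps
      by (intro exI[of _ "v(k := 0)"]) (auto intro!: sum.cong)
  next
    case False
    define d where "d = A $ k $ k"
    have d: "d > 0" using psd_diag_nonneg[OF insert.prems(1), of k] False by (simp add: d_def)
    have sym: "A $ i $ j = A $ j $ i" for i j
      using insert.prems(1) by (simp add: psd_mats_def sym_mats_nth)
    \<comment> \<open>\<open>w\<close> is the pivot column scaled so that
      \<open>w $ i * w $ j\<close> reproduces row and column \<open>k\<close> of \<open>A\<close>;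
      what remains is \<open>B\<close>, the Schur complement padded with zeros.\<close>
    define w where "w = (\<chi> i. A $ i $ k / sqrt d)"
    define B where "B = (\<chi> i j. A $ i $ j - w $ i * w $ j)"
    have ww: "w $ i * w $ j = A $ i $ k * A $ j $ k / d" for i j
      using d by (simp add: w_def)
    have Bq: "x \<bullet> (B *v x) = x \<bullet> (A *v x) - (w \<bullet> x)\<^sup>2" for x
      unfolding quadratic_form_expand
      unfolding inner_vec_def power2_eq_square sum_product sum_subtractf[symmetric] B_def
      by (simp add: algebra_simps)
    have "B \<in> psd_mats"
      unfolding psd_mats_def
    proof safe
      show "B \<in> sym_mats" using sym by (simp add: sym_mats_nth B_def algebra_simps)
      fix x
      \<comment> \<open>This \<open>t\<close> minimises the form of \<open>A\<close> along the line
        \<open>x + t *\<^sub>R axis k 1\<close>. The minimum is the form of \<open>B\<close> at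
        \<open>x\<close>, so it inherits the sign.\<close>
      define t where "t = - (w \<bullet> x) / sqrt d"
      have Ak: "A *v axis k 1 = sqrt d *\<^sub>R w"
        using d by (simp add: matrix_vector_mult_basis column_def w_def Finite_Cartesian_Product.vec_eq_iff)
      have xAk: "axis k 1 \<bullet> (A *v x) = sqrt d * (w \<bullet> x)"
        using Ak insert.prems(1)
        by (subst inner_matrix_vector_mult_transpose) (simp add: psd_mats_def sym_mats_def)
      then have Axk: "(A *v x) $ k = sqrt d * (w \<bullet> x)"
        by (simp add: inner_axis')
      have wk: "w $ k = sqrt d"
        using d by (simp add: w_def d_def[symmetric] real_div_sqrt)
      have "0 \<le> (x + t *\<^sub>R axis k 1) \<bullet> (A *v (x + t *\<^sub>R axis k 1))"
        using insert.prems(1) by (simp add: psd_mats_def)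
      also have "\<dots> = x \<bullet> (A *v x) + 2 * t * sqrt d * (w \<bullet> x) + t * t * d"
        using d by (simp add: matrix_vector_right_distrib matrix_vector_mult_scaleR inner_add_left
            inner_add_right Ak Axk inner_axis' wk inner_commute[of x w] algebra_simps)
      also have "\<dots> = x \<bullet> (A *v x) - (w \<bullet> x)\<^sup>2"
        using d by (simp add: t_def power2_eq_square field_simps)
      finally show "0 \<le> x \<bullet> (B *v x)" by (simp add: Bq)
    qed
    moreover have "B $ i $ j = 0" if "i \<notin> S" for i j
    proof (cases "i = k")
      case True
      then show ?thesis using d sym[of j k] by (simp add: B_def ww) (simp add: d_def)
    next
      case False
      then have "A $ i $ l = 0" for l using insert.prems(2) that by blast
      then show ?thesis by (simp add: B_def ww)
    qed
    ultimately obtain v :: "'p \<Rightarrow> real^'p"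
      where v: "\<forall>i j. B $ i $ j = (\<Sum>k\<in>S. v k $ i * v k $ j)"
      using insert.IH by blast
    have "A $ i $ j = (\<Sum>l\<in>insert k S. (v(k := w)) l $ i * (v(k := w)) l $ j)" for i j
    proof -
      have "(\<Sum>l\<in>insert k S. (v(k := w)) l $ i * (v(k := w)) l $ j) = w $ i * w $ j + B $ i $ j"
        using insert.hyps v by (auto intro!: sum.cong)
      then show ?thesis by (simp add: B_def)
    qed
    then show ?thesis by blast
  qed
qed

text \<open>The sum is the trace of H^T P H Q. With Q written as a sum of squares v v^T it becomes
  the sum of the values of the form of \<open>P\<close> at the vectors \<open>H *v v k\<close>. All
  of them vanish, hence \<open>H ** Q = 0\<close>, and \<open>Q\<close> cancels. Uniqueness of the
  completion and both invertibility arguments below rest on this.\<close>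

lemma sum_mult_sandwich_posdef_zero_imp_zero:
  fixes P Q H :: "'p::finite sq_mat"
  assumes P: "P \<in> posdef_mats" and Q: "Q \<in> posdef_mats"
    and zero: "(\<Sum>i\<in>UNIV. \<Sum>j\<in>UNIV. H $ i $ j * (P ** H ** Q) $ i $ j) = 0"
  shows "H = 0"
proof -
  obtain v :: "'p \<Rightarrow> real^'p" where v: "\<And>i j. Q $ i $ j = (\<Sum>k\<in>UNIV. v k $ i * v k $ j)"
    using psd_sum_of_squares[OF _ posdef_imp_psd[OF Q], of UNIV] by auto
  define w where "w k = P *v (H *v v k)" for k
  have PHQ: "(P ** H ** Q) $ i $ j = (\<Sum>k\<in>UNIV. w k $ i * v k $ j)" for i j
  proof -
    have "(P ** H ** Q) $ i $ j = (\<Sum>l\<in>UNIV. \<Sum>k\<in>UNIV. (P ** H) $ i $ l * v k $ l * v k $ j)"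
      by (simp add: matrix_matrix_mult_def[of "P ** H"] v sum_distrib_left mult.assoc)
    also have "\<dots> = (\<Sum>k\<in>UNIV. w k $ i * v k $ j)"
      unfolding w_def matrix_vector_mul_assoc
      by (subst sum.swap) (simp add: matrix_vector_mult_def sum_distrib_right)
    finally show ?thesis .
  qed
  have "(\<Sum>k\<in>UNIV. (H *v v k) \<bullet> w k)
      = (\<Sum>k\<in>UNIV. \<Sum>i\<in>UNIV. \<Sum>j\<in>UNIV. H $ i $ j * (w k $ i * v k $ j))"
    unfolding inner_vec_def matrix_vector_mult_def
    by (simp add: sum_distrib_left sum_distrib_right mult_ac)
  also have "\<dots> = (\<Sum>i\<in>UNIV. \<Sum>k\<in>UNIV. \<Sum>j\<in>UNIV. H $ i $ j * (w k $ i * v k $ j))"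
    by (rule sum.swap)
  also have "\<dots> = (\<Sum>i\<in>UNIV. \<Sum>j\<in>UNIV. \<Sum>k\<in>UNIV. H $ i $ j * (w k $ i * v k $ j))"
    by (rule sum.cong[OF refl], rule sum.swap)
  also have "\<dots> = (\<Sum>i\<in>UNIV. \<Sum>j\<in>UNIV. H $ i $ j * (P ** H ** Q) $ i $ j)"
    by (simp only: PHQ sum_distrib_left)
  also note zero
  finally have sum0: "(\<Sum>k\<in>UNIV. (H *v v k) \<bullet> w k) = 0" .
  have "(H *v v k) \<bullet> w k = 0" for k
  proof -
    have "0 \<le> (H *v v k) \<bullet> w k" for k
      using posdef_imp_psd[OF P] by (simp add: psd_mats_def w_def)
    with sum0 show ?thesis by (simp add: sum_nonneg_eq_0_iff)
  qed
  then have Hv: "H *v v k = 0" for k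
    using P unfolding posdef_mats_def w_def by (metis (mono_tags, lifting) less_irrefl mem_Collect_eq)
  have "(H ** Q) $ i $ j = (\<Sum>k\<in>UNIV. (H *v v k) $ i * v k $ j)" for i j
  proof -
    have "(H ** Q) $ i $ j = (\<Sum>l\<in>UNIV. \<Sum>k\<in>UNIV. H $ i $ l * v k $ l * v k $ j)"
      by (simp add: matrix_matrix_mult_def v sum_distrib_left mult.assoc)
    also have "\<dots> = (\<Sum>k\<in>UNIV. (H *v v k) $ i * v k $ j)"
      by (subst sum.swap) (simp add: matrix_vector_mult_def sum_distrib_right)
    finally show ?thesis .
  qed
  then have "H ** Q = 0" by (simp add: Hv Finite_Cartesian_Product.vec_eq_iff)
  then show ?thesis
    by (metis matrix_inv_right_left(1)[OF posdef_invertible[OF Q]] matrix_mul_assoc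
        matrix_mul_rid times0_left)
qed

subsection \<open>Existence and uniqueness of the completion\<close>

lemma bounded_bilinear_matrix_mult:
  "bounded_bilinear ((**) :: real^'n^'n \<Rightarrow> real^'n^'n \<Rightarrow> real^'n^'n)"
  unfolding bilinear_conv_bounded_bilinear[symmetric] bilinear_def
  by (auto intro!: linearI
      simp: matrix_matrix_mult_def Finite_Cartesian_Product.vec_eq_iff distrib_left distrib_right
      sum.distrib sum_distrib_left mult_ac)

interpretation matrix_mult: bounded_bilinear "(**) :: real^'n^'n \<Rightarrow> real^'n^'n \<Rightarrow> real^'n^'n"
  by (rule bounded_bilinear_matrix_mult)

lemma continuous_on_det:
  fixes f :: "'a::topological_space \<Rightarrow> real^'n^'n"
  assumes "\<And>i j. continuous_on S (\<lambda>x. f x $ i $ j)"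
  shows "continuous_on S (\<lambda>x. det (f x))"
  unfolding det_def
  by (intro continuous_on_sum continuous_on_mult continuous_on_prod continuous_on_const assms)

text \<open>In the Leibniz formula a permutation other than the identity moves at least two indices,
  so after one factor is differentiated another one still vanishes at 0. Only the identity
  contributes, and its term is the trace.\<close>

lemma det_id_plus_scaleR_has_real_derivative:
  fixes X :: "real^'n^'n"
  shows "((\<lambda>t. det (Finite_Cartesian_Product.mat 1 + t *\<^sub>R X)) has_real_derivative
    (\<Sum>i\<in>UNIV. X $ i $ i)) (at 0)"
proof -
  let ?P = "{p. p permutes (UNIV::'n set)}"
  let ?\<delta> = "\<lambda>i j. if i = j then 1 else (0::real)"
  let ?D = "\<lambda>p. \<Sum>i\<in>UNIV. X $ i $ p i * (\<Prod>j\<in>UNIV-{i}. ?\<delta> j (p j))"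
  have fin: "finite ?P" by (simp add: finite_permutations)
  have "((\<lambda>t. \<Prod>i\<in>UNIV. ?\<delta> i (p i) + t * X $ i $ p i) has_derivative
      (\<lambda>y. \<Sum>i\<in>UNIV. (y * X $ i $ p i) * (\<Prod>j\<in>UNIV-{i}. ?\<delta> j (p j) + 0 * X $ j $ p j))) (at 0)"
    for p :: "'n \<Rightarrow> 'n"
    by (rule has_derivative_prod) (auto intro!: derivative_eq_intros)
  then have prod: "((\<lambda>t. \<Prod>i\<in>UNIV. ?\<delta> i (p i) + t * X $ i $ p i) has_real_derivative ?D p) (at 0)"
    for p :: "'n \<Rightarrow> 'n"
    unfolding has_field_derivative_def
    by (rule has_derivative_eq_rhs) (auto simp: sum_distrib_left mult_ac)
  have "((\<lambda>t. \<Sum>p\<in>?P. of_int (sign p) * (\<Prod>i\<in>UNIV. ?\<delta> i (p i) + t * X $ i $ p i))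
      has_real_derivative (\<Sum>p\<in>?P. of_int (sign p) * ?D p)) (at 0)"
    by (intro DERIV_sum DERIV_cmult prod)
  moreover have "(\<Sum>p\<in>?P. of_int (sign p) * ?D p) = (\<Sum>p\<in>{id}. of_int (sign p) * ?D p)"
  proof (rule sum.mono_neutral_right[OF fin])
    show "{id} \<subseteq> ?P" by (simp add: permutes_id)
    show "\<forall>p\<in>?P - {id}. of_int (sign p) * ?D p = 0"
    proof
      fix p assume p: "p \<in> ?P - {id}"
      then obtain k where k: "p k \<noteq> k" by fastforce
      \<comment> \<open>\<open>k\<close> and \<open>p k\<close> are two moved indices, so at least
        one of them survives the removal of \<open>i\<close>.\<close>
      have "p (p k) \<noteq> p k"
        using k p by (metis DiffD1 mem_Collect_eq permutes_inj injD)
      have "(\<Prod>j\<in>UNIV-{i}. ?\<delta> j (p j)) = 0" for i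
      proof (cases "i = k")
        case True
        with k \<open>p (p k) \<noteq> p k\<close> show ?thesis by (intro prod_zero) (auto intro!: bexI[of _ "p k"])
      next
        case False
        with k show ?thesis by (intro prod_zero) (auto intro!: bexI[of _ k])
      qed
      then show "of_int (sign p) * ?D p = 0" by (simp only: mult_zero_right sum.neutral_const)
    qed
  qed
  ultimately show ?thesis
    by (simp add: det_def Finite_Cartesian_Product.mat_def sign_id)
qed

text \<open>The complement is the projection, along the compact unit sphere, of a closed set of
  pairs, hence closed. Scaling passes from unit vectors to all nonzero \<open>x\<close>.\<close>

lemma open_pos_quadratic_form: "open {B::real^'n^'n. \<forall>x. x \<noteq> 0 \<longrightarrow> x \<bullet> (B *v x) > 0}"
proof -
  let ?T = "{(x::real^'n, B::real^'n^'n). x \<bullet> (B *v x) \<le> 0}"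
  have "closed ?T"
    unfolding case_prod_beta quadratic_form_expand
    by (intro closed_Collect_le continuous_intros)
  then have "closed {B. \<exists>x. x \<in> sphere 0 1 \<and> (x, B) \<in> ?T}"
    by (intro closed_compact_projection) auto
  then have "open (- {B. \<exists>x. x \<in> sphere 0 1 \<and> (x, B) \<in> ?T})"
    by (rule open_Compl)
  also have "- {B. \<exists>x. x \<in> sphere 0 1 \<and> (x, B) \<in> ?T}
      = {B::real^'n^'n. \<forall>x. x \<noteq> 0 \<longrightarrow> x \<bullet> (B *v x) > 0}"
  proof safe
    fix B :: "real^'n^'n" and x :: "real^'n"
    assume B: "\<nexists>x. x \<in> sphere 0 1 \<and> (x, B) \<in> ?T" and x: "x \<noteq> 0"
    let ?y = "x /\<^sub>R norm x"
    have "?y \<in> sphere 0 1" using x by simp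
    with B have "(?y, B) \<notin> ?T" by blast
    then have "?y \<bullet> (B *v ?y) > 0" by (simp only: mem_Collect_eq case_prod_conv not_le)
    then show "x \<bullet> (B *v x) > 0"
      using x by (simp add: matrix_vector_mult_scaleR zero_less_mult_iff)
  next
    fix B :: "real^'n^'n" and x :: "real^'n"
    assume "\<forall>x. x \<noteq> 0 \<longrightarrow> x \<bullet> (B *v x) > 0" "x \<in> sphere 0 1" and le: "x \<bullet> (B *v x) \<le> 0"
    moreover from this have "x \<noteq> 0" by auto
    ultimately have "x \<bullet> (B *v x) > 0" by blast
    with le show False by linarith
  qed
  finally show ?thesis .
qed

text \<open>Evaluate the form at the sum and at the difference of two unit vectors.\<close>

lemma psd_entry_bound: "\<bar>A $ i $ j\<bar> \<le> (A $ i $ i + A $ j $ j) / 2" if "A \<in> psd_mats"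
proof -
  have s: "A $ j $ i = A $ i $ j" using that by (simp add: psd_mats_def sym_mats_nth)
  have "0 \<le> (axis i 1 + axis j 1) \<bullet> (A *v (axis i 1 + axis j 1))"
    "0 \<le> (axis i 1 - axis j 1) \<bullet> (A *v (axis i 1 - axis j 1))"
    using that by (simp_all add: psd_mats_def)
  then show ?thesis
    by (simp add: matrix_vector_right_distrib matrix_vector_mult_diff_distrib inner_add_left
        inner_add_right inner_diff_left inner_diff_right matrix_vector_mult_basis inner_axis' column_def s)
qed

definition psd_completions :: "'p::finite set set \<Rightarrow> 'p sq_mat \<Rightarrow> 'p sq_mat set" where
  "psd_completions E A = {B \<in> psd_mats. \<forall>i j. {i, j} \<in> E \<or> i = j \<longrightarrow> B $ i $ j = A $ i $ j}"

text \<open>Semidefiniteness, unlike definiteness, survives limits, and the prescribed diagonal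
  bounds every other entry.\<close>

lemma compact_psd_completions:
  fixes A :: "'p::finite sq_mat"
  shows "compact (psd_completions E A)"
proof -
  have "closed {B::'p sq_mat. \<forall>i j. B $ i $ j = B $ j $ i}"
    by (intro closed_Collect_all closed_Collect_eq continuous_intros)
  moreover have "closed {B::'p sq_mat. \<forall>x. 0 \<le> x \<bullet> (B *v x)}"
    unfolding quadratic_form_expand
    by (intro closed_Collect_all closed_Collect_le continuous_intros)
  moreover have "closed {B::'p sq_mat. \<forall>i j. {i, j} \<in> E \<or> i = j \<longrightarrow> B $ i $ j = A $ i $ j}"
    by (intro closed_Collect_all closed_Collect_imp closed_Collect_eq continuous_intros) auto
  moreover have "psd_completions E A = {B. \<forall>i j. B $ i $ j = B $ j $ i} \<inter>
      {B. \<forall>x. 0 \<le> x \<bullet> (B *v x)} \<inter> {B. \<forall>i j. {i, j} \<in> E \<or> i = j \<longrightarrow> B $ i $ j = A $ i $ j}"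
    by (auto simp: psd_completions_def psd_mats_def sym_mats_nth)
  ultimately have "closed (psd_completions E A)" by (simp add: closed_Int)
  moreover have "bounded (psd_completions E A)"
  proof (rule boundedI)
    fix B assume B: "B \<in> psd_completions E A"
    have "norm B \<le> (\<Sum>i\<in>UNIV. norm (B $ i))" by (simp add: norm_vec_def L2_set_le_sum)
    also have "\<dots> \<le> (\<Sum>i\<in>UNIV. \<Sum>j\<in>UNIV. \<bar>B $ i $ j\<bar>)"
      by (intro sum_mono norm_le_l1_cart)
    also have "\<dots> \<le> (\<Sum>i\<in>UNIV. \<Sum>j\<in>UNIV. (A $ i $ i + A $ j $ j) / 2)"
    proof (intro sum_mono)
      fix i j
      have "B $ i $ i = A $ i $ i" "B $ j $ j = A $ j $ j" "B \<in> psd_mats"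
        using B by (auto simp: psd_completions_def)
      with psd_entry_bound[of B i j] show "\<bar>B $ i $ j\<bar> \<le> (A $ i $ i + A $ j $ j) / 2" by simp
    qed
    finally show "norm B \<le> (\<Sum>i\<in>UNIV. \<Sum>j\<in>UNIV. (A $ i $ i + A $ j $ j) / 2)" .
  qed
  ultimately show ?thesis by (simp add: compact_eq_bounded_closed)
qed

text \<open>The condition under the definite description in \<open>h_G\<close>, named so that
  existence and uniqueness can be treated separately.\<close>

definition is_completion :: "'p::finite set set \<Rightarrow> 'p sq_mat \<Rightarrow> 'p sq_mat \<Rightarrow> bool" where
  "is_completion E A B \<longleftrightarrow> B \<in> posdef_mats \<and>
     (\<forall>i j. {i, j} \<in> E \<or> i = j \<longrightarrow> B $ i $ j = A $ i $ j) \<and>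
     (\<forall>i j. {i, j} \<notin> E \<and> i \<noteq> j \<longrightarrow> matrix_inv B $ i $ j = 0)"

text \<open>The completion maximises the determinant over all positive semidefinite matrices that
  agree with \<open>A\<close> on the edges and on the diagonal.\<close>

lemma completion_exists:
  fixes A :: "'p::finite sq_mat"
  assumes A: "A \<in> posdef_mats"
  shows "\<exists>B. is_completion E A B"
proof -
  have A_in: "A \<in> psd_completions E A"
    using posdef_imp_psd[OF A] by (simp add: psd_completions_def)
  \<comment> \<open>Squaring makes the sign of the determinant irrelevant. As \<open>A\<close>
    itself competes and is invertible, the maximiser is invertible and so positive definite.\<close>
  have "continuous_on (psd_completions E A) (\<lambda>B. (det B)\<^sup>2)"
    by (intro continuous_on_power continuous_on_det continuous_intros)
  then obtain B where B: "B \<in> psd_completions E A"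
      and max: "\<And>C. C \<in> psd_completions E A \<Longrightarrow> (det C)\<^sup>2 \<le> (det B)\<^sup>2"
    using continuous_attains_sup[OF compact_psd_completions] A_in by (metis empty_iff)
  have "det A \<noteq> 0" using posdef_invertible[OF A] by (simp add: invertible_det_nz)
  then have "0 < (det A)\<^sup>2" by simp
  with max[OF A_in] have det: "det B \<noteq> 0" by auto
  then have inv: "invertible B" by (simp add: invertible_det_nz)
  with B have pd: "B \<in> posdef_mats"
    by (auto simp: psd_completions_def intro: psd_invertible_imp_posdef)
  have "matrix_inv B $ i $ j = 0" if ij: "{i, j} \<notin> E" "i \<noteq> j" for i j
  proof -
    \<comment> \<open>The symmetric direction that changes only the free entries
      \<open>(i, j)\<close> and \<open>(j, i)\<close>.\<close>
    define C :: "'p sq_mat" where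
      "C = (\<chi> k l. if k = i \<and> l = j \<or> k = j \<and> l = i then 1 else 0)"
    define X where "X = matrix_inv B ** C"
    let ?f = "\<lambda>t. (det (B + t *\<^sub>R C))\<^sup>2"
    have f: "?f t = (det B)\<^sup>2 * (det (Finite_Cartesian_Product.mat 1 + t *\<^sub>R X))\<^sup>2" for t
    proof -
      have "B + t *\<^sub>R C = B ** (Finite_Cartesian_Product.mat 1 + t *\<^sub>R X)"
        by (simp add: X_def matrix_mult.add_right matrix_mult.scaleR_right matrix_mul_assoc
            matrix_inv_right_left[OF inv])
      then show ?thesis by (simp add: det_mul power_mult_distrib)
    qed
    \<comment> \<open>\<open>X\<close> is chosen so that \<open>B + t *\<^sub>R C\<close> is
      \<open>B\<close> times a perturbation of the identity. Stationarity will make the trace of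
      \<open>X\<close> zero, and this trace is twice the entry \<open>(i, j)\<close> of the inverse
      of \<open>B\<close>.\<close>
    have "(?f has_real_derivative (det B)\<^sup>2 * (2 * (\<Sum>k\<in>UNIV. X $ k $ k))) (at 0)"
      unfolding f
      by (rule derivative_eq_intros det_id_plus_scaleR_has_real_derivative refl | simp)+
    \<comment> \<open>By openness \<open>B + t *\<^sub>R C\<close> stays positive definite for small
      \<open>t\<close> of either sign, so it competes with \<open>B\<close>.\<close>
    moreover have "\<exists>d>0. \<forall>t. \<bar>0 - t\<bar> < d \<longrightarrow> ?f t \<le> ?f 0"
    proof -
      let ?U = "{B::'p sq_mat. \<forall>x. x \<noteq> 0 \<longrightarrow> x \<bullet> (B *v x) > 0}"
      have "open ((\<lambda>t. B + t *\<^sub>R C) -` ?U)"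
        by (intro open_vimage open_pos_quadratic_form continuous_intros)
      moreover have "0 \<in> (\<lambda>t. B + t *\<^sub>R C) -` ?U" using pd by (simp add: posdef_mats_def)
      ultimately obtain d where d: "d > 0" "ball 0 d \<subseteq> (\<lambda>t. B + t *\<^sub>R C) -` ?U"
        by (meson open_contains_ball)
      have "?f t \<le> ?f 0" if "\<bar>0 - t\<bar> < d" for t
      proof -
        have "t \<in> ball 0 d" using that by (simp add: dist_real_def)
        then have "B + t *\<^sub>R C \<in> ?U" using d(2) by blast
        moreover have "B + t *\<^sub>R C \<in> sym_mats"
          using pd by (auto simp: posdef_mats_def sym_mats_nth C_def)
        ultimately have "B + t *\<^sub>R C \<in> psd_mats"
          by (intro posdef_imp_psd) (simp add: posdef_mats_def)
        moreover have "(B + t *\<^sub>R C) $ k $ l = B $ k $ l" if "{k, l} \<in> E \<or> k = l" for k l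
          using that ij by (auto simp: C_def insert_commute)
        ultimately have "B + t *\<^sub>R C \<in> psd_completions E A"
          using B by (auto simp: psd_completions_def)
        then show ?thesis using max by simp
      qed
      then show ?thesis using d(1) by blast
    qed
    ultimately have "(det B)\<^sup>2 * (2 * (\<Sum>k\<in>UNIV. X $ k $ k)) = 0"
      using DERIV_local_max by blast
    then have "(\<Sum>k\<in>UNIV. X $ k $ k) = 0" using det by simp
    moreover have "X $ k $ k = (if k = i then matrix_inv B $ i $ j else 0)
        + (if k = j then matrix_inv B $ j $ i else 0)" for k
    proof -
      have "X $ k $ k = (\<Sum>l\<in>UNIV. (if l = j \<and> k = i then matrix_inv B $ i $ j else 0)
        + (if l = i \<and> k = j then matrix_inv B $ j $ i else 0))"
        unfolding X_def matrix_matrix_mult_def C_def using ij by (auto intro!: sum.cong)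
      then show ?thesis by (simp add: sum.distrib)
    qed
    moreover have "matrix_inv B $ j $ i = matrix_inv B $ i $ j"
      using posdef_matrix_inv[OF pd] by (simp add: posdef_mats_def sym_mats_nth)
    ultimately show ?thesis by (simp add: sum.distrib)
  qed
  then show ?thesis
    using B pd by (auto simp: is_completion_def psd_completions_def)
qed

text \<open>Sandwiching \<open>B - C\<close> between the two inverses gives the difference of the
  inverses. \<open>B - C\<close> vanishes at edges and on the diagonal, that difference at all other
  positions, so the trace inequality applies to \<open>B - C\<close>.\<close>

lemma completion_unique:
  fixes A :: "'p::finite sq_mat"
  assumes B: "is_completion E A B" and C: "is_completion E A C"
  shows "B = C"
proof -
  have pd: "B \<in> posdef_mats" "C \<in> posdef_mats" using B C by (simp_all add: is_completion_def)
  note iB = matrix_inv_right_left[OF posdef_invertible[OF pd(1)]]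
  note iC = matrix_inv_right_left[OF posdef_invertible[OF pd(2)]]
  have "matrix_inv B ** (B - C) ** matrix_inv C = matrix_inv C - matrix_inv B"
    by (simp add: matrix_mult.diff_left matrix_mult.diff_right iB iC) (simp add: iC flip: matrix_mul_assoc)
  moreover have "(B - C) $ i $ j * (matrix_inv C - matrix_inv B) $ i $ j = 0" for i j
    using B C unfolding is_completion_def by (cases "{i, j} \<in> E \<or> i = j") auto
  ultimately have "(\<Sum>i\<in>UNIV. \<Sum>j\<in>UNIV.
      (B - C) $ i $ j * (matrix_inv B ** (B - C) ** matrix_inv C) $ i $ j) = 0"
    by (simp only: sum.neutral_const)
  then have "B - C = 0"
    by (rule sum_mult_sandwich_posdef_zero_imp_zero[OF posdef_matrix_inv[OF pd(1)]
        posdef_matrix_inv[OF pd(2)]])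
  then show ?thesis by simp
qed

lemma h_G_eqI:
  assumes "is_completion E A B"
  shows "h_G E A = B"
  unfolding h_G_def is_completion_def[symmetric]
  using assms completion_unique[OF _ assms] by (rule the_equality)

lemma h_G_is_completion:
  assumes "A \<in> posdef_mats"
  shows "is_completion E A (h_G E A)"
proof -
  obtain B where "is_completion E A B" using completion_exists[OF assms] by blast
  with h_G_eqI[OF this] show ?thesis by simp
qed

subsection \<open>Differentiability of the completion map\<close>

lemma matrix_inv_nth_cramer:
  fixes A :: "real^'n^'n"
  assumes "invertible A"
  shows "matrix_inv A $ i $ j =
    det (\<chi> k l. if l = i then (if k = j then 1 else 0) else A $ k $ l) / det A"
proof -
  \<comment> \<open>Column \<open>j\<close> of the inverse solves a linear system, so Cramer's rule
    writes its entries as quotients of determinants, which are visibly continuous.\<close>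
  have "A *v (matrix_inv A *v axis j 1) = axis j 1"
    by (simp add: matrix_vector_mul_assoc matrix_inv_right_left[OF assms])
  moreover have "det A \<noteq> 0" using assms by (simp add: invertible_det_nz)
  ultimately have "matrix_inv A *v axis j 1
      = (\<chi> i. det (\<chi> k l. if l = i then axis j 1 $ k else A $ k $ l) / det A)"
    by (simp add: cramer)
  then have "(matrix_inv A *v axis j 1) $ i
      = det (\<chi> k l. if l = i then axis j 1 $ k else A $ k $ l) / det A"
    by simp
  moreover have "(matrix_inv A *v axis j 1) $ i = matrix_inv A $ i $ j"
    by (simp add: matrix_vector_mult_basis column_def)
  moreover have "axis j (1::real) $ k = (if k = j then 1 else 0)" for k
    by (simp add: axis_def)
  ultimately show ?thesis by (simp only:)
qed

lemma continuous_on_matrix_inv: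
  fixes f :: "'a::topological_space \<Rightarrow> real^'n^'n"
  assumes f: "continuous_on S f" and inv: "\<And>x. x \<in> S \<Longrightarrow> invertible (f x)"
  shows "continuous_on S (\<lambda>x. matrix_inv (f x))"
proof -
  have "continuous_on S (\<lambda>x. (\<chi> i j.
      det (\<chi> k l. if l = i then (if k = j then 1 else 0) else f x $ k $ l) / det (f x)))"
  proof (intro continuous_on_vec_lambda continuous_on_divide continuous_on_det ballI)
    fix i j k l :: 'n
    show "continuous_on S (\<lambda>x. (\<chi> k l. if l = i then (if k = j then 1 else 0) else f x $ k $ l) $ k $ l)"
      using f by (cases "l = i"; cases "k = j") (simp_all add: continuous_on_component)
    show "continuous_on S (\<lambda>x. f x $ k $ l)" by (intro continuous_intros f)
  qed (use inv invertible_det_nz in blast)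
  then show ?thesis
    by (rule continuous_on_eq)
      (simp add: Finite_Cartesian_Product.vec_eq_iff matrix_inv_nth_cramer inv)
qed

lemma open_invertible: "open {A::real^'n^'n. invertible A}"
  unfolding invertible_det_nz
  by (intro open_Collect_neq continuous_on_det continuous_intros)

text \<open>The remainder factors exactly as \<open>?I ** (X - A) ** (?I - matrix_inv X)\<close>.
  Divided by the norm of \<open>X - A\<close>, it is bounded by a multiple of the last factor, which
  tends to 0 by continuity of inversion.\<close>

lemma has_derivative_matrix_inv:
  fixes A :: "real^'n^'n"
  assumes inv: "invertible A"
  shows "(matrix_inv has_derivative (\<lambda>H. - (matrix_inv A ** H ** matrix_inv A))) (at A)"
proof -
  let ?I = "matrix_inv A"
  let ?D = "\<lambda>H. - (?I ** H ** ?I)"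
  obtain K where K: "\<And>(X :: real^'n^'n) (Y :: real^'n^'n). norm (X ** Y) \<le> norm X * norm Y * K"
    using matrix_mult.bounded by metis
  have near: "eventually (\<lambda>X. invertible X) (at A)"
    using inv open_invertible by (auto simp: eventually_at_topological)
  have "bounded_linear ?D"
    by (intro bounded_linear_minus bounded_linear_compose[OF matrix_mult.bounded_linear_left
        matrix_mult.bounded_linear_right])
  moreover have "((\<lambda>X. norm ((matrix_inv X - ?I) - ?D (X - A)) / norm (X - A)) \<longlongrightarrow> 0) (at A)"
  proof (rule Lim_null_comparison)
    show "eventually (\<lambda>X. norm (norm ((matrix_inv X - ?I) - ?D (X - A)) / norm (X - A))
        \<le> (norm ?I * \<bar>K\<bar>) * \<bar>K\<bar> * norm (?I - matrix_inv X)) (at A)"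
      using near
    proof (rule eventually_mono)
      fix X :: "real^'n^'n" assume X: "invertible X"
      have "?I ** (X - A) ** (?I - matrix_inv X) = (matrix_inv X - ?I) - ?D (X - A)"
        by (simp add: matrix_mult.diff_left matrix_mult.diff_right matrix_inv_right_left[OF inv])
          (simp add: matrix_inv_right_left[OF X] flip: matrix_mul_assoc)
      moreover have "norm (?I ** (X - A) ** (?I - matrix_inv X))
          \<le> norm (?I ** (X - A)) * norm (?I - matrix_inv X) * \<bar>K\<bar>"
        by (rule order_trans[OF K]) (simp add: mult_left_mono)
      moreover have "norm (?I ** (X - A)) \<le> norm ?I * norm (X - A) * \<bar>K\<bar>"
        by (rule order_trans[OF K]) (simp add: mult_left_mono)
      then have "norm (?I ** (X - A)) * norm (?I - matrix_inv X) * \<bar>K\<bar>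
          \<le> (norm ?I * norm (X - A) * \<bar>K\<bar>) * norm (?I - matrix_inv X) * \<bar>K\<bar>"
        by (intro mult_right_mono) auto
      ultimately have "norm ((matrix_inv X - ?I) - ?D (X - A))
          \<le> (norm ?I * \<bar>K\<bar>) * \<bar>K\<bar> * norm (?I - matrix_inv X) * norm (X - A)"
        by (simp add: mult_ac)
      then show "norm (norm ((matrix_inv X - ?I) - ?D (X - A)) / norm (X - A))
        \<le> (norm ?I * \<bar>K\<bar>) * \<bar>K\<bar> * norm (?I - matrix_inv X)"
        by (cases "X = A") (simp_all add: pos_divide_le_eq)
    qed
    have "continuous_on {A::real^'n^'n. invertible A} matrix_inv"
      by (rule continuous_on_matrix_inv) auto
    then have "isCont matrix_inv A"
      using continuous_on_eq_continuous_at[OF open_invertible] inv by blast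
    then have "((\<lambda>X. ?I - matrix_inv X) \<longlongrightarrow> ?I - ?I) (at A)"
      by (intro tendsto_intros) (simp add: isCont_def)
    then show "((\<lambda>X. (norm ?I * \<bar>K\<bar>) * \<bar>K\<bar> * norm (?I - matrix_inv X)) \<longlongrightarrow> 0) (at A)"
      by (intro tendsto_mult_right_zero tendsto_norm_zero) simp
  qed
  ultimately show ?thesis by (simp add: has_derivative_iff_norm)
qed

section \<open>Half-vectorised coordinates on the symmetric matrices\<close>

definition low_pos :: "'p::linorder \<Rightarrow> 'p \<Rightarrow> 'p lowtri" where
  "low_pos i j = Abs_lowtri (if j \<le> i then (i, j) else (j, i))"

lemma Rep_low_pos: "Rep_lowtri (low_pos i j) = (if j \<le> i then (i, j) else (j, i))"
  unfolding low_pos_def by (subst Abs_lowtri_inverse) auto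

lemma low_pos_Rep: "low_pos (fst (Rep_lowtri k)) (snd (Rep_lowtri k)) = k"
  using Rep_lowtri[of k] by (auto simp: low_pos_def Rep_lowtri_inverse split: prod.splits)

lemma low_pos_commute: "low_pos i j = low_pos j i"
  by (auto simp: low_pos_def)

lemma all_lowtri: "(\<forall>k. P k) \<longleftrightarrow> (\<forall>i j. P (low_pos i j))"
  by (metis low_pos_Rep)

text \<open>The inverse of \<open>v_of\<close> on \<open>sym_mats\<close>; it carries statements
  about coordinate vectors back to matrices.\<close>

definition mat_of_v :: "real^'p lowtri \<Rightarrow> ('p::{finite,linorder}) sq_mat" where
  "mat_of_v x = (\<chi> i j. x $ low_pos i j)"

lemma mat_of_v_nth [simp]: "mat_of_v x $ i $ j = x $ low_pos i j"
  by (simp add: mat_of_v_def)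

lemma mat_of_v_sym: "mat_of_v x \<in> sym_mats"
  by (simp add: sym_mats_nth low_pos_commute)

lemma v_of_low_pos: "A \<in> sym_mats \<Longrightarrow> v_of A $ low_pos i j = A $ i $ j"
  by (simp add: v_of_def vec_of_def Rep_low_pos sym_mats_nth)

lemma v_of_mat_of_v [simp]: "v_of (mat_of_v x) = x"
  by (simp add: Finite_Cartesian_Product.vec_eq_iff all_lowtri v_of_low_pos mat_of_v_sym)

lemma mat_of_v_v_of: "A \<in> sym_mats \<Longrightarrow> mat_of_v (v_of A) = A"
  by (simp add: Finite_Cartesian_Product.vec_eq_iff v_of_low_pos)

lemma bounded_linear_v_of: "bounded_linear v_of"
  by (auto intro!: linearI simp: v_of_def vec_of_def Finite_Cartesian_Product.vec_eq_iff
      split: prod.splits simp flip: linear_conv_bounded_linear)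

lemma bounded_linear_mat_of_v: "bounded_linear mat_of_v"
  by (auto intro!: linearI simp: Finite_Cartesian_Product.vec_eq_iff
      simp flip: linear_conv_bounded_linear)

lemma sandwich_sym:
  assumes "A \<in> sym_mats" "B \<in> sym_mats"
  shows "A ** B ** A \<in> sym_mats"
  using assms by (simp add: sym_mats_def matrix_transpose_mul matrix_mul_assoc)

lemma posdef_imp_sym: "A \<in> posdef_mats \<Longrightarrow> A \<in> sym_mats"
  by (simp add: posdef_mats_def)

text \<open>The image of \<open>posdef_mats\<close> under \<open>v_of\<close>, written as a preimage
  under a continuous map so that its openness is immediate from that of the positive forms.\<close>

definition posdef_vs :: "(real^('p::{finite,linorder}) lowtri) set" where
  "posdef_vs = {x. mat_of_v x \<in> posdef_mats}"

lemma v_of_image_posdef: "v_of ` posdef_mats = posdef_vs"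
proof safe
  fix A :: "'a sq_mat" assume "A \<in> posdef_mats"
  then show "v_of A \<in> posdef_vs" by (simp add: posdef_vs_def mat_of_v_v_of posdef_imp_sym)
next
  fix x :: "real^'a lowtri" assume "x \<in> posdef_vs"
  then show "x \<in> v_of ` posdef_mats"
    by (intro image_eqI[of _ _ "mat_of_v x"]) (auto simp: posdef_vs_def)
qed

lemma open_posdef_vs: "open posdef_vs"
proof -
  have "open (mat_of_v -` {B::'a sq_mat. \<forall>x. x \<noteq> 0 \<longrightarrow> x \<bullet> (B *v x) > 0})"
    by (intro open_vimage open_pos_quadratic_form linear_continuous_on bounded_linear_mat_of_v)
  moreover have "mat_of_v -` {B::'a sq_mat. \<forall>x. x \<noteq> 0 \<longrightarrow> x \<bullet> (B *v x) > 0} = posdef_vs"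
    by (auto simp: posdef_vs_def posdef_mats_def mat_of_v_sym)
  ultimately show ?thesis by simp
qed

lemma half_vec_map_posdef:
  "x \<in> posdef_vs \<Longrightarrow> half_vec_map posdef_mats h x = v_of (h (mat_of_v x))"
proof -
  assume x: "x \<in> posdef_vs"
  have "inj_on v_of (posdef_mats :: 'a sq_mat set)"
    by (metis inj_onI mat_of_v_v_of posdef_imp_sym)
  then have "inv_into posdef_mats v_of (v_of (mat_of_v x)) = mat_of_v x"
    using x by (intro inv_into_f_f) (auto simp: posdef_vs_def)
  then show ?thesis by (simp add: half_vec_map_def)
qed

section \<open>Mixed coordinates and their Jacobian\<close>

definition edge_pos :: "'p::linorder set set \<Rightarrow> 'p lowtri \<Rightarrow> bool" where
  "edge_pos E k \<longleftrightarrow> (case Rep_lowtri k of (i, j) \<Rightarrow> {i, j} \<in> E \<or> i = j)"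

lemma edge_pos_low_pos: "edge_pos E (low_pos i j) \<longleftrightarrow> {i, j} \<in> E \<or> i = j"
  by (auto simp: edge_pos_def Rep_low_pos insert_commute)

text \<open>In Gaussian terms: covariances at edges and on the diagonal, concentrations at the
  non-edges.\<close>

definition mixed_coords :: "'p::{finite,linorder} set set \<Rightarrow> real^'p lowtri \<Rightarrow> real^'p lowtri" where
  "mixed_coords E x =
    (\<chi> k. if edge_pos E k then x $ k else v_of (matrix_inv (mat_of_v x)) $ k)"

text \<open>The Jacobi matrix of \<open>mixed_coords E\<close>. A row at a non-edge holds the
  derivative of inversion in the coordinate directions \<open>axis l 1\<close>.\<close>

definition mixed_jac :: "'p::{finite,linorder} set set \<Rightarrow> real^'p lowtri \<Rightarrow> real^'p lowtri^'p lowtri" where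
  "mixed_jac E x = (\<chi> k l. if edge_pos E k then (if k = l then 1 else 0)
     else - v_of (matrix_inv (mat_of_v x) ** mat_of_v (axis l 1) ** matrix_inv (mat_of_v x)) $ k)"

definition edge_proj :: "'p::{finite,linorder} set set \<Rightarrow> real^'p lowtri^'p lowtri" where
  "edge_proj E = (\<chi> k l. if edge_pos E k \<and> k = l then 1 else 0)"

lemma edge_proj_mult: "(edge_proj E *v x) $ k = (if edge_pos E k then x $ k else 0)"
  by (simp add: edge_proj_def matrix_vector_mult_def if_distrib[of "\<lambda>a. a * _"] cong: if_cong)

lemma mixed_jac_mult:
  "(mixed_jac E x *v y) $ k = (if edge_pos E k then y $ k
     else - v_of (matrix_inv (mat_of_v x) ** mat_of_v y ** matrix_inv (mat_of_v x)) $ k)"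
proof (cases "edge_pos E k")
  case True
  then show ?thesis
    by (simp add: mixed_jac_def matrix_vector_mult_def if_distrib[of "\<lambda>a. a * _"] cong: if_cong)
next
  case False
  let ?I = "matrix_inv (mat_of_v x)"
  let ?L = "\<lambda>y. - v_of (?I ** mat_of_v y ** ?I)"
  have "bounded_linear ?L"
    by (intro bounded_linear_minus bounded_linear_v_of[THEN bounded_linear_compose]
        matrix_mult.bounded_linear_left[THEN bounded_linear_compose]
        matrix_mult.bounded_linear_right[THEN bounded_linear_compose] bounded_linear_mat_of_v)
  then have "?L y = matrix ?L *v y"
    by (simp add: bounded_linear.linear matrix_works)
  then have "?L y $ k = (\<Sum>l\<in>UNIV. ?L (axis l 1) $ k * y $ l)"
    by (simp add: matrix_def matrix_vector_mult_def)
  with False show ?thesis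
    by (simp add: mixed_jac_def matrix_vector_mult_def)
qed

text \<open>A kernel vector is a symmetric matrix that vanishes at edges and on the diagonal while
  its sandwich by the inverse vanishes at the non-edges. The trace inequality makes it zero.\<close>

lemma mixed_jac_invertible:
  assumes x: "x \<in> posdef_vs"
  shows "invertible (mixed_jac E x)"
proof (rule invertible_if_ker_trivial)
  fix y assume y0: "mixed_jac E x *v y = 0"
  let ?I = "matrix_inv (mat_of_v x)"
  have I: "?I \<in> posdef_mats" using x by (simp add: posdef_vs_def posdef_matrix_inv)
  have "mat_of_v y $ i $ j * (?I ** mat_of_v y ** ?I) $ i $ j = 0" for i j
  proof -
    have "(mixed_jac E x *v y) $ low_pos i j = 0" by (simp add: y0)
    then show ?thesis
      by (simp add: mixed_jac_mult v_of_low_pos sandwich_sym posdef_imp_sym[OF I] mat_of_v_sym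
          split: if_splits)
  qed
  then have "(\<Sum>i\<in>UNIV. \<Sum>j\<in>UNIV. mat_of_v y $ i $ j * (?I ** mat_of_v y ** ?I) $ i $ j) = 0"
    by (simp only: sum.neutral_const)
  then have "mat_of_v y = 0"
    by (rule sum_mult_sandwich_posdef_zero_imp_zero[OF I I])
  then have "v_of (mat_of_v y) = v_of 0" by simp
  then show "y = 0"
    by (simp add: linear_0 bounded_linear.linear bounded_linear_v_of)
qed

lemma has_derivative_mixed_coords:
  assumes x: "x \<in> posdef_vs"
  shows "(mixed_coords E has_derivative (*v) (mixed_jac E x)) (at x)"
proof -
  let ?I = "matrix_inv (mat_of_v x)"
  have inv: "invertible (mat_of_v x)" using x by (simp add: posdef_vs_def posdef_invertible)
  have "((\<lambda>y. matrix_inv (mat_of_v y)) has_derivative (\<lambda>h. - (?I ** mat_of_v h ** ?I))) (at x)"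
    using has_derivative_compose[OF bounded_linear_imp_has_derivative[OF bounded_linear_mat_of_v]
        has_derivative_matrix_inv[OF inv]] .
  then have "((\<lambda>y. v_of (matrix_inv (mat_of_v y))) has_derivative
      (\<lambda>h. v_of (- (?I ** mat_of_v h ** ?I)))) (at x)"
    by (rule bounded_linear.has_derivative[OF bounded_linear_v_of])
  then have v: "((\<lambda>y. v_of (matrix_inv (mat_of_v y))) has_derivative
      (\<lambda>h. - v_of (?I ** mat_of_v h ** ?I))) (at x)"
    by (simp add: linear_neg bounded_linear.linear[OF bounded_linear_v_of])
  have comp: "((\<lambda>y. mixed_coords E y $ k) has_derivative (\<lambda>h. (mixed_jac E x *v h) $ k)) (at x)" for k
  proof (cases "edge_pos E k")
    case True
    then show ?thesis
      by (simp add: mixed_coords_def mixed_jac_mult bounded_linear_imp_has_derivative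
          bounded_linear_vec_nth)
  next
    case False
    then show ?thesis
      using bounded_linear.has_derivative[OF bounded_linear_vec_nth v, of k]
      by (simp add: mixed_coords_def mixed_jac_mult)
  qed
  show ?thesis
    by (subst has_derivative_componentwise_within)
      (auto simp: Basis_vec_def inner_axis comp)
qed

lemma continuous_on_mixed_jac:
  "continuous_on posdef_vs (mixed_jac E)"
proof -
  have "continuous_on posdef_vs (\<lambda>x. matrix_inv (mat_of_v x))"
    by (intro continuous_on_matrix_inv linear_continuous_on bounded_linear_mat_of_v)
      (simp add: posdef_vs_def posdef_invertible)
  then have "continuous_on posdef_vs (\<lambda>x. v_of (matrix_inv (mat_of_v x) ** mat_of_v (axis l 1)
      ** matrix_inv (mat_of_v x)) $ k)" for k l
    by (intro continuous_on_component bounded_linear.continuous_on[OF bounded_linear_v_of]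
        matrix_mult.continuous_on continuous_on_const)
  then have "continuous_on posdef_vs (\<lambda>x. if edge_pos E k then (if k = l then 1 else 0)
     else - v_of (matrix_inv (mat_of_v x) ** mat_of_v (axis l 1) ** matrix_inv (mat_of_v x)) $ k)" for k l
    by (cases "edge_pos E k") (auto intro!: continuous_on_minus)
  then show ?thesis
    unfolding mixed_jac_def[abs_def] by (intro continuous_on_vec_lambda)
qed

section \<open>The completion map as a local inverse of the mixed coordinates\<close>

definition completion_v :: "'p::{finite,linorder} set set \<Rightarrow> real^'p lowtri \<Rightarrow> real^'p lowtri" where
  "completion_v E x = v_of (h_G E (mat_of_v x))"

lemma h_G_posdef: "A \<in> posdef_mats \<Longrightarrow> h_G E A \<in> posdef_mats"
  using h_G_is_completion by (auto simp: is_completion_def)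

lemma mat_of_v_completion_v: "x \<in> posdef_vs \<Longrightarrow> mat_of_v (completion_v E x) = h_G E (mat_of_v x)"
  by (simp add: completion_v_def posdef_vs_def mat_of_v_v_of posdef_imp_sym h_G_posdef)

lemma completion_v_posdef: "x \<in> posdef_vs \<Longrightarrow> completion_v E x \<in> posdef_vs"
  using mat_of_v_completion_v[of x E] by (simp add: posdef_vs_def h_G_posdef)

text \<open>The projected vector carries both conditions at once: the entries of \<open>x\<close>
  where they are prescribed, and elsewhere the zeros required of the inverse.\<close>

lemma is_completion_iff_mixed_coords:
  assumes "b \<in> posdef_vs"
  shows "is_completion E (mat_of_v x) (mat_of_v b) \<longleftrightarrow> mixed_coords E b = edge_proj E *v x"
proof -
  have b: "mat_of_v b \<in> posdef_mats" using assms by (simp add: posdef_vs_def)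
  then have "v_of (matrix_inv (mat_of_v b)) $ low_pos i j = matrix_inv (mat_of_v b) $ i $ j" for i j
    by (simp add: v_of_low_pos posdef_imp_sym posdef_matrix_inv)
  with b show ?thesis
    unfolding is_completion_def Finite_Cartesian_Product.vec_eq_iff all_lowtri
    by (auto simp: mixed_coords_def edge_proj_mult edge_pos_low_pos split: if_splits)
qed

lemma mixed_coords_completion_v:
  assumes "x \<in> posdef_vs"
  shows "mixed_coords E (completion_v E x) = edge_proj E *v x"
proof -
  have "mat_of_v x \<in> posdef_mats" using assms by (simp add: posdef_vs_def)
  then have "is_completion E (mat_of_v x) (mat_of_v (completion_v E x))"
    unfolding mat_of_v_completion_v[OF assms] by (rule h_G_is_completion)
  then show ?thesis
    using is_completion_iff_mixed_coords[OF completion_v_posdef[OF assms]] by blast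
qed

lemma completion_v_eqI:
  assumes "b \<in> posdef_vs" "mixed_coords E b = edge_proj E *v x"
  shows "completion_v E x = b"
  using assms is_completion_iff_mixed_coords h_G_eqI by (metis completion_v_def v_of_mat_of_v)

text \<open>Near \<open>x\<close> the completion is \<open>g\<close> after the projection, where
  \<open>g\<close> is the local inverse of \<open>mixed_coords E\<close> at the completion of
  \<open>x\<close>; the chain rule gives the product.\<close>

lemma has_derivative_completion_v:
  assumes x: "x \<in> posdef_vs"
  shows "(completion_v E has_derivative (*v) (matrix_inv (mixed_jac E (completion_v E x)) ** edge_proj E)) (at x)"
proof -
  \<comment> \<open>The inverse function theorem asks for the derivative as a bounded operator that
    depends continuously on the point.\<close>
  let ?f' = "\<lambda>y. Blinfun ((*v) (mixed_jac E y))"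
  have f': "blinfun_apply (?f' y) = (*v) (mixed_jac E y)" for y
    by (rule bounded_linear_Blinfun_apply) simp
  let ?J = "mixed_jac E (completion_v E x)"
  note J = matrix_inv_right_left[OF mixed_jac_invertible[OF completion_v_posdef[OF x]], of E E]
  obtain U V g g' where UV: "U \<subseteq> posdef_vs" "open V" "mixed_coords E (completion_v E x) \<in> V"
      "homeomorphism U V (mixed_coords E) g"
      and g: "\<And>y. y \<in> V \<Longrightarrow> (g has_derivative (g' y)) (at y)"
      "\<And>y. y \<in> V \<Longrightarrow> g' y = Hilbert_Choice.inv (blinfun_apply (?f' (g y)))"
  proof (rule inverse_function_theorem[OF open_posdef_vs, of "mixed_coords E" ?f' "completion_v E x"
        "Blinfun ((*v) (matrix_inv ?J))"])
    show "(mixed_coords E has_derivative blinfun_apply (?f' y)) (at y)" if "y \<in> posdef_vs" for y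
      using has_derivative_mixed_coords[OF that] by (simp add: f')
    show "continuous_on posdef_vs ?f'"
    proof (rule continuous_on_blinfun_componentwise)
      fix i :: "real^'a lowtri"
      have "continuous_on posdef_vs (\<lambda>y. mixed_jac E y *v i)"
        unfolding matrix_vector_mult_def
        by (intro continuous_intros continuous_on_mixed_jac)
      then show "continuous_on posdef_vs (\<lambda>y. blinfun_apply (?f' y) i)" by (simp add: f')
    qed
    show "completion_v E x \<in> posdef_vs" by (rule completion_v_posdef[OF x])
    show "Blinfun ((*v) (matrix_inv ?J)) o\<^sub>L ?f' (completion_v E x) = id_blinfun"
      by (rule blinfun_eqI) (simp add: f' bounded_linear_Blinfun_apply matrix_vector_mul_assoc J)
  qed blast
  let ?P = "(*v) (edge_proj E)"
  have Px: "?P x \<in> V" using UV(3) by (simp add: mixed_coords_completion_v[OF x])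
  \<comment> \<open>\<open>g\<close> yields a positive definite matrix with the right mixed
    coordinates; by uniqueness it is the completion.\<close>
  have gP: "completion_v E z = g (?P z)" if "?P z \<in> V" for z
  proof (rule completion_v_eqI)
    show "g (?P z) \<in> posdef_vs"
      using UV(1,4) that by (auto simp: homeomorphism_def)
    show "mixed_coords E (g (?P z)) = ?P z"
      using UV(4) that by (simp add: homeomorphism_def)
  qed
  have "g' (?P x) = Hilbert_Choice.inv ((*v) ?J)"
    by (simp add: g(2)[OF Px] f' gP[OF Px])
  also have "\<dots> = (*v) (matrix_inv ?J)"
    by (rule inv_unique_comp) (auto simp: fun_eq_iff matrix_vector_mul_assoc J)
  finally have g'P: "g' (?P x) = (*v) (matrix_inv ?J)" .
  have "(?P has_derivative ?P) (at x)"
    by (rule bounded_linear_imp_has_derivative) simp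
  from has_derivative_compose[OF this g(1)[OF Px]]
  have "((\<lambda>z. g (?P z)) has_derivative (\<lambda>h. matrix_inv ?J *v (?P h))) (at x)"
    by (simp add: g'P)
  then have "((\<lambda>z. g (?P z)) has_derivative (*v) (matrix_inv ?J ** edge_proj E)) (at x)"
    by (simp add: matrix_vector_mul_assoc)
  then show ?thesis
  proof (rule has_derivative_transform_within_open)
    show "open (?P -` V)"
      using UV(2) by (intro open_vimage) (auto intro!: continuous_intros)
    show "x \<in> ?P -` V" using Px by simp
  qed (simp add: gP)
qed

lemma has_derivative_half_vec_map_h_G:
  assumes x: "x \<in> posdef_vs"
  shows "(half_vec_map posdef_mats (h_G E) has_derivative
    (*v) (matrix_inv (mixed_jac E (completion_v E x)) ** edge_proj E)) (at x)"
  using has_derivative_completion_v[OF x] open_posdef_vs x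
  by (rule has_derivative_transform_within_open) (simp add: half_vec_map_posdef completion_v_def)

lemma jacobian_half_vec_map_h_G:
  assumes "x \<in> posdef_vs"
  shows "jacobian (half_vec_map posdef_mats (h_G E)) (at x) =
    matrix_inv (mixed_jac E (completion_v E x)) ** edge_proj E"
  unfolding jacobian_def frechet_derivative_at[OF has_derivative_half_vec_map_h_G[OF assms], symmetric]
  by (rule matrix_of_matrix_vector_mul)

lemma cont_differentiable_on_h_G: "cont_differentiable_on (h_G E) posdef_mats"
  unfolding cont_differentiable_on_def v_of_image_posdef
proof (intro conjI ballI)
  show "posdef_mats \<subseteq> sym_mats" "h_G E ` posdef_mats \<subseteq> sym_mats"
    using posdef_imp_sym h_G_posdef by auto
  show "open posdef_vs" by (rule open_posdef_vs)
  show "half_vec_map posdef_mats (h_G E) differentiable at x" if "x \<in> posdef_vs" for x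
    using has_derivative_half_vec_map_h_G[OF that] by (rule differentiableI)
  \<comment> \<open>The Jacobi matrix is explicit, so its continuity is that of the completion, of
    \<open>mixed_jac\<close> and of inversion.\<close>
  have "continuous_on posdef_vs (completion_v E)"
    by (intro continuous_at_imp_continuous_on ballI has_derivative_continuous[OF has_derivative_completion_v])
  then have "continuous_on posdef_vs (\<lambda>x. mixed_jac E (completion_v E x))"
    by (rule continuous_on_compose2[OF continuous_on_mixed_jac]) (auto simp: completion_v_posdef)
  then have "continuous_on posdef_vs (\<lambda>x. matrix_inv (mixed_jac E (completion_v E x)))"
    by (rule continuous_on_matrix_inv) (simp add: mixed_jac_invertible completion_v_posdef)
  then have "continuous_on posdef_vs (\<lambda>x. matrix_inv (mixed_jac E (completion_v E x)) ** edge_proj E)"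
    by (intro matrix_mult.continuous_on continuous_on_const)
  then show "continuous_on posdef_vs (\<lambda>x. jacobian (half_vec_map posdef_mats (h_G E)) (at x))"
    by (rule continuous_on_eq) (simp add: jacobian_half_vec_map_h_G)
qed

subsection \<open>The derivative as a matrix\<close>

definition unvec :: "real^('p::finite \<times> 'p) \<Rightarrow> 'p sq_mat" where
  "unvec z = (\<chi> i j. z $ (i, j))"

lemma vec_of_nth [simp]: "vec_of A $ (i, j) = A $ i $ j"
  by (simp add: vec_of_def)

lemma vec_of_unvec [simp]: "vec_of (unvec z) = z"
  by (simp add: Finite_Cartesian_Product.vec_eq_iff unvec_def)

lemma vec_of_inject [simp]: "vec_of A = vec_of B \<longleftrightarrow> A = B"
  by (simp add: Finite_Cartesian_Product.vec_eq_iff)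

text \<open>Every vector is a vectorisation, so matrices with these columns may be compared by their
  action on \<open>p \<times> p\<close> matrices.\<close>

lemma matrix_eq_vec_of:
  fixes A B :: "real^('p::finite \<times> 'p)^'n"
  assumes "\<And>X. A *v vec_of X = B *v vec_of X"
  shows "A = B"
  unfolding matrix_eq by (metis assms vec_of_unvec)

text \<open>The orthogonal projection onto \<open>sym_mats\<close>, which both \<open>M_mat\<close>
  and \<open>dup_mat ** dup_mat_pinv\<close> represent.\<close>

definition sym_part :: "('p::finite) sq_mat \<Rightarrow> 'p sq_mat" where
  "sym_part X = (1 / 2) *\<^sub>R (X + transpose X)"

lemma sym_part_nth: "sym_part X $ i $ j = (X $ i $ j + X $ j $ i) / 2"
  by (simp add: sym_part_def transpose_def)

lemma sym_part_sym: "sym_part X \<in> sym_mats"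
  by (simp add: sym_mats_nth sym_part_nth add.commute)

lemma sym_part_sandwich:
  fixes A X :: "'p::finite sq_mat"
  assumes "transpose A = A"
  shows "sym_part (A ** X ** A) = A ** sym_part X ** A"
  by (simp add: sym_part_def matrix_mult.scaleR_left matrix_mult.scaleR_right
      matrix_mult.add_left matrix_mult.add_right matrix_transpose_mul assms matrix_mul_assoc)

text \<open>Every \<open>y\<close> is the half-vectorisation of the symmetric matrix
  \<open>mat_of_v y\<close>, so the defining property fixes the matrix and the definite description
  denotes.\<close>

lemma dup_mat_mult:
  fixes y :: "real^('a::{finite,linorder} lowtri)"
  shows "dup_mat *v y = vec_of (mat_of_v y)"
proof -
  let ?D = "matrix (\<lambda>y. vec_of (mat_of_v y)) :: real^('a lowtri)^('a \<times> 'a)"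
  have "linear (\<lambda>y. vec_of (mat_of_v y) :: real^('a \<times> 'a))"
    by (auto intro!: linearI simp: Finite_Cartesian_Product.vec_eq_iff)
  then have D: "?D *v y = vec_of (mat_of_v y)" for y by (simp add: matrix_works)
  have dup: "dup_mat = ?D"
    unfolding dup_mat_def
  proof (rule the_equality)
    show "\<forall>A\<in>sym_mats. ?D *v v_of A = vec_of A" by (simp add: D mat_of_v_v_of)
    fix D' :: "real^('a lowtri)^('a \<times> 'a)"
    assume "\<forall>A\<in>sym_mats. D' *v v_of A = vec_of A"
    then have "D' *v y = ?D *v y" for y
      using mat_of_v_sym[of y] by (force simp: D)
    then show "D' = ?D" by (simp add: matrix_eq)
  qed
  show ?thesis unfolding dup by (rule D)
qed

lemma sum_UNIV_prod: "(\<Sum>c\<in>UNIV. f c) = (\<Sum>l\<in>UNIV. \<Sum>b\<in>UNIV. f (l, b))"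
  for f :: "'a::finite \<times> 'b::finite \<Rightarrow> 'c::comm_monoid_add"
  by (simp add: sum.cartesian_product flip: UNIV_Times_UNIV)

lemma inner_vec_of: "vec_of A \<bullet> vec_of B = (\<Sum>i\<in>UNIV. \<Sum>j\<in>UNIV. A $ i $ j * B $ i $ j)"
  by (simp add: inner_vec_def sum_UNIV_prod)

lemma inner_vec_of_sym_part:
  assumes "A \<in> sym_mats"
  shows "vec_of A \<bullet> vec_of X = vec_of A \<bullet> vec_of (sym_part X)"
proof -
  have "(\<Sum>i\<in>UNIV. \<Sum>j\<in>UNIV. A $ i $ j * X $ j $ i) = (\<Sum>i\<in>UNIV. \<Sum>j\<in>UNIV. A $ i $ j * X $ i $ j)"
    using assms by (subst sum.swap) (simp add: sym_mats_nth)
  then show ?thesis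
    by (simp add: inner_vec_of sym_part_nth distrib_left add_divide_distrib sum.distrib
        flip: sum_divide_distrib)
qed

text \<open>The half-vectorised symmetric part solves the normal equations, since symmetric matrices
  are orthogonal to the antisymmetric part of \<open>X\<close>. The Gram matrix is invertible
  because duplication is injective.\<close>

lemma dup_mat_pinv_mult: "dup_mat_pinv *v vec_of X = v_of (sym_part X)"
proof -
  let ?D = "dup_mat :: real^('a lowtri)^('a \<times> 'a)"
  let ?G = "transpose ?D ** ?D"
  have "invertible ?G"
  proof (rule invertible_if_ker_trivial)
    fix y assume "?G *v y = 0"
    then have "y \<bullet> (transpose ?D *v (?D *v y)) = 0" by (simp add: matrix_vector_mul_assoc)
    then have "(?D *v y) \<bullet> (?D *v y) = 0"
      by (subst (asm) inner_matrix_vector_mult_transpose) simp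
    then have "mat_of_v y = mat_of_v 0"
      by (simp add: dup_mat_mult Finite_Cartesian_Product.vec_eq_iff)
    then show "y = 0" by (metis v_of_mat_of_v)
  qed
  note inv = matrix_inv_right_left(2)[OF this]
  have "transpose ?D *v vec_of X = ?G *v v_of (sym_part X)"
  proof (rule vector_eq_rdot[THEN iffD1], rule allI)
    fix y
    have "y \<bullet> (transpose ?D *v vec_of X) = vec_of (mat_of_v y) \<bullet> vec_of X"
      by (subst inner_matrix_vector_mult_transpose) (simp add: dup_mat_mult)
    also have "\<dots> = vec_of (mat_of_v y) \<bullet> (?D *v v_of (sym_part X))"
      by (subst inner_vec_of_sym_part) (simp_all add: mat_of_v_sym dup_mat_mult mat_of_v_v_of sym_part_sym)
    also have "\<dots> = y \<bullet> (?G *v v_of (sym_part X))"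
      unfolding matrix_vector_mul_assoc[symmetric]
      by (subst (2) inner_matrix_vector_mult_transpose) (simp add: dup_mat_mult)
    finally show "(transpose ?D *v vec_of X) \<bullet> y = (?G *v v_of (sym_part X)) \<bullet> y"
      by (simp add: inner_commute)
  qed
  then show ?thesis
    unfolding dup_mat_pinv_def
    by (metis inv matrix_vector_mul_assoc matrix_vector_mul_lid)
qed

lemma unit_mat_nth: "unit_mat i j $ a $ b = (if a = i \<and> b = j then 1 else 0)"
  by (simp add: unit_mat_def matrix_matrix_mult_def columnvector_def rowvector_def axis_def)

lemma K_mat_nth: "K_mat $ (k, a) $ (l, b) = (if a = l \<and> b = k then 1 else 0)"
proof -
  have "K_mat $ (k, a) $ (l, b) = (\<Sum>i\<in>UNIV. \<Sum>j\<in>UNIV.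
      if a = i \<and> b = j \<and> k = j \<and> l = i then 1 else 0)"
    by (simp add: K_mat_def kron_def unit_mat_nth) (auto intro!: sum.cong)
  also have "\<dots> = (\<Sum>i\<in>UNIV. if i = a then (if a = l \<and> b = k then 1 else 0) else 0)"
  proof (rule sum.cong[OF refl])
    fix i
    have "(\<Sum>j\<in>UNIV. if a = i \<and> b = j \<and> k = j \<and> l = i then 1 else (0::real))
        = (\<Sum>j\<in>UNIV. if j = b then (if a = i \<and> k = b \<and> l = i then 1 else 0) else 0)"
      by (rule sum.cong) auto
    then show "(\<Sum>j\<in>UNIV. if a = i \<and> b = j \<and> k = j \<and> l = i then 1 else (0::real))
        = (if i = a then (if a = l \<and> b = k then 1 else 0) else 0)"
      by auto
  qed
  finally show ?thesis by simp
qed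

lemma K_mat_mult: "K_mat *v vec_of X = vec_of (transpose X)"
proof -
  have "(K_mat *v vec_of X) $ (k, a) = X $ a $ k" for k a
  proof -
    have "(K_mat *v vec_of X) $ (k, a)
        = (\<Sum>l\<in>UNIV. \<Sum>b\<in>UNIV. (if a = l \<and> b = k then 1 else 0) * X $ l $ b)"
      by (simp add: matrix_vector_mult_def sum_UNIV_prod K_mat_nth)
    also have "\<dots> = (\<Sum>l\<in>UNIV. \<Sum>b\<in>UNIV. if b = k then (if l = a then X $ l $ b else 0) else 0)"
      by (intro sum.cong refl) auto
    finally show ?thesis by simp
  qed
  then show ?thesis
    by (simp add: Finite_Cartesian_Product.vec_eq_iff transpose_def)
qed

lemma M_mat_mult: "M_mat *v vec_of X = vec_of (sym_part X)"
proof -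
  have "M_mat *v vec_of X = (1 / 2) *\<^sub>R (vec_of X + vec_of (transpose X))"
    by (simp add: M_mat_def matrix_vector_mult_add_rdistrib K_mat_mult flip: scaleR_matrix_vector_assoc)
  then show ?thesis
    by (simp add: Finite_Cartesian_Product.vec_eq_iff sym_part_nth transpose_def)
qed

text \<open>The outer factor \<open>A\<close> acts on the column index, hence its place on the right
  and its transposition.\<close>

lemma kron_mult: "kron A B *v vec_of X = vec_of (B ** X ** transpose A)"
proof -
  have "(kron A B *v vec_of X) $ (k, a) = (B ** X ** transpose A) $ k $ a" for k a
  proof -
    have "(kron A B *v vec_of X) $ (k, a)
        = (\<Sum>l\<in>UNIV. \<Sum>b\<in>UNIV. B $ k $ l * X $ l $ b * A $ a $ b)"
      unfolding matrix_vector_mult_def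
      by (simp add: sum_UNIV_prod kron_def mult_ac)
    also have "\<dots> = (\<Sum>b\<in>UNIV. \<Sum>l\<in>UNIV. B $ k $ l * X $ l $ b * A $ a $ b)"
      by (rule sum.swap)
    finally show ?thesis
      by (simp add: matrix_matrix_mult_def transpose_def sum_distrib_right)
  qed
  then show ?thesis
    by (simp add: Finite_Cartesian_Product.vec_eq_iff)
qed

text \<open>Equals Q^T Q for the selection matrix Q of \<open>Z\<close>. Its size does not depend on
  the graph, so the algebra can be done with it before Q itself appears.\<close>

definition sel_mat :: "'n set \<Rightarrow> real^'n^'n::finite" where
  "sel_mat Z = (\<chi> a b. if a = b \<and> a \<in> Z then 1 else 0)"

lemma sel_mat_mult_nth: "(sel_mat Z *v z) $ a = (if a \<in> Z then z $ a else 0)"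
  by (simp add: sel_mat_def matrix_vector_mult_def if_distrib[of "\<lambda>t. t * _"] cong: if_cong)

lemma sel_mat_idem: "sel_mat Z ** sel_mat Z = sel_mat Z"
  by (simp add: matrix_eq Finite_Cartesian_Product.vec_eq_iff sel_mat_mult_nth
      flip: matrix_vector_mul_assoc)

lemma M_mat_kron_commute:
  assumes "transpose A = A"
  shows "M_mat ** kron A A = kron A A ** M_mat"
  by (rule matrix_eq_vec_of)
    (simp add: M_mat_mult kron_mult assms sym_part_sandwich flip: matrix_vector_mul_assoc)

lemma D_set_iff: "{i, j} \<notin> E \<and> i \<noteq> j \<longleftrightarrow> (i, j) \<in> D_set E \<or> (j, i) \<in> D_set E"
  for i j :: "'p::linorder"
  by (auto simp: D_set_def insert_commute)

lemma D_set_asym: "(i, j) \<in> D_set E \<Longrightarrow> (j, i) \<notin> D_set E"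
  for i j :: "'p::linorder"
  by (auto simp: D_set_def)

section \<open>The derivative at a fixed matrix and the inverse of the compression\<close>

locale completion_derivative =
  fixes E :: "'p::{finite,linorder} set set" and A :: "'p sq_mat"
  assumes A: "A \<in> posdef_mats"
begin

abbreviation "I \<equiv> matrix_inv (h_G E A)"
abbreviation "W \<equiv> kron I I"
abbreviation "F \<equiv> matrix_deriv posdef_mats (h_G E) A"
abbreviation "P \<equiv> sel_mat (D_set E)"
abbreviation "M \<equiv> M_mat :: ('p \<times> 'p) sq_mat"

lemma I: "I \<in> posdef_mats"
  by (simp add: posdef_matrix_inv h_G_posdef A)

lemma I_transpose: "transpose I = I"
  by (simp add: posdef_transpose I)

text \<open>\<open>K\<close> is the derivative of \<open>h_G E\<close> in the direction
  \<open>sym_part X\<close>. Its two properties are the edge rows and the non-edge rows of the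
  linear system with matrix \<open>mixed_jac\<close>.\<close>

lemma directional_derivative:
  obtains K where "F *v vec_of X = vec_of K" "K \<in> sym_mats"
    "\<And>i j. {i, j} \<in> E \<or> i = j \<Longrightarrow> K $ i $ j = sym_part X $ i $ j"
    "\<And>i j. {i, j} \<notin> E \<and> i \<noteq> j \<Longrightarrow> (I ** K ** I) $ i $ j = 0"
proof -
  let ?x = "v_of (sym_part X)"
  have vA: "v_of A \<in> posdef_vs" using A by (simp add: posdef_vs_def mat_of_v_v_of posdef_imp_sym)
  have completion_v: "completion_v E (v_of A) = v_of (h_G E A)"
    by (simp add: completion_v_def mat_of_v_v_of posdef_imp_sym A)
  have mv: "mat_of_v (v_of (h_G E A)) = h_G E A"
    by (simp add: mat_of_v_v_of posdef_imp_sym h_G_posdef A)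
  let ?J = "mixed_jac E (v_of (h_G E A))"
  let ?y = "(matrix_inv ?J ** edge_proj E) *v ?x"
  have "?J ** matrix_inv ?J = Finite_Cartesian_Product.mat 1"
    using matrix_inv_right_left(1)[OF mixed_jac_invertible[where E = E, OF completion_v_posdef[where E = E, OF vA]]] by (simp add: completion_v)
  then have Jy: "?J *v ?y = edge_proj E *v ?x"
    by (metis matrix_mul_assoc matrix_mul_lid matrix_vector_mul_assoc)
  show thesis
  proof (rule that)
    show "F *v vec_of X = vec_of (mat_of_v ?y)"
      by (simp add: matrix_deriv_def jacobian_half_vec_map_h_G[OF vA] completion_v dup_mat_pinv_mult
          dup_mat_mult flip: matrix_vector_mul_assoc)
    show "mat_of_v ?y \<in> sym_mats" by (rule mat_of_v_sym)
    show "mat_of_v ?y $ i $ j = sym_part X $ i $ j" if "{i, j} \<in> E \<or> i = j" for i j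
      using arg_cong[OF Jy, of "\<lambda>v. v $ low_pos i j"] that
      unfolding mixed_jac_mult edge_proj_mult edge_pos_low_pos
      by (simp add: v_of_low_pos sym_part_sym)
    show "(I ** mat_of_v ?y ** I) $ i $ j = 0" if "{i, j} \<notin> E \<and> i \<noteq> j" for i j
    proof -
      have "I ** mat_of_v ?y ** I \<in> sym_mats"
        by (intro sandwich_sym posdef_imp_sym I mat_of_v_sym)
      from v_of_low_pos[OF this] show ?thesis
        using arg_cong[OF Jy, of "\<lambda>v. v $ low_pos i j"] that
        unfolding mixed_jac_mult edge_proj_mult edge_pos_low_pos mv
        by simp
    qed
  qed
qed

text \<open>On a vectorised matrix, \<open>M - F\<close> gives a symmetric matrix supported at the
  non-edges. \<open>P\<close> keeps only its lower half; symmetrising restores both halves at half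
  the size, whence the factor 2.\<close>

lemma derivative_correction: "M - F = M ** P ** (2 *\<^sub>R (M - F))"
proof (rule matrix_eq_vec_of)
  fix X
  obtain K where K: "F *v vec_of X = vec_of K" "K \<in> sym_mats"
    "\<And>i j. {i, j} \<in> E \<or> i = j \<Longrightarrow> K $ i $ j = sym_part X $ i $ j"
    using directional_derivative by metis
  let ?N = "sym_part X - K"
  have MF: "(M - F) *v vec_of X = vec_of ?N"
    by (simp add: matrix_vector_mult_diff_rdistrib M_mat_mult K Finite_Cartesian_Product.vec_eq_iff)
  let ?R = "(\<chi> i j. if (i, j) \<in> D_set E then 2 * ?N $ i $ j else 0) :: 'p sq_mat"
  have "P *v (2 *\<^sub>R vec_of ?N) = vec_of ?R"
    by (auto simp: Finite_Cartesian_Product.vec_eq_iff sel_mat_mult_nth)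
  then have "(M ** P ** (2 *\<^sub>R (M - F))) *v vec_of X = vec_of (sym_part ?R)"
    by (simp add: MF M_mat_mult flip: matrix_vector_mul_assoc scaleR_matrix_vector_assoc)
  moreover have "sym_part ?R $ i $ j = ?N $ i $ j" for i j
  proof (cases "{i, j} \<in> E \<or> i = j")
    case True
    then have "(i, j) \<notin> D_set E" "(j, i) \<notin> D_set E" using D_set_iff by blast+
    with True show ?thesis by (simp add: sym_part_nth K(3))
  next
    case False
    have "?N $ j $ i = ?N $ i $ j"
      using K(2) sym_part_sym[of X] by (simp add: sym_mats_nth)
    moreover have "(i, j) \<in> D_set E \<and> (j, i) \<notin> D_set E \<or> (j, i) \<in> D_set E \<and> (i, j) \<notin> D_set E"
      using False D_set_iff[of i j E] D_set_asym by blast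
    ultimately show ?thesis by (auto simp: sym_part_nth)
  qed
  ultimately show "(M - F) *v vec_of X = (M ** P ** (2 *\<^sub>R (M - F))) *v vec_of X"
    by (simp add: MF Finite_Cartesian_Product.vec_eq_iff)
qed

text \<open>The inverse of the completion is constantly zero at the non-edges, hence so is its
  derivative, which is \<open>I ** K ** I\<close> up to sign.\<close>

lemma derivative_orthogonality: "P ** W ** F = 0"
proof (rule matrix_eq_vec_of)
  fix X
  obtain K where K: "F *v vec_of X = vec_of K"
    "\<And>i j. {i, j} \<notin> E \<and> i \<noteq> j \<Longrightarrow> (I ** K ** I) $ i $ j = 0"
    using directional_derivative by metis
  have "(I ** K ** I) $ i $ j = 0" if "(i, j) \<in> D_set E" for i j
    using that D_set_iff K(2) by blast
  then show "(P ** W ** F) *v vec_of X = 0 *v vec_of X"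
    by (simp add: K(1) kron_mult I_transpose sel_mat_mult_nth Finite_Cartesian_Product.vec_eq_iff
        flip: matrix_vector_mul_assoc)
qed

text \<open>Padding the compression with the identity outside \<open>D\<close> turns its inversion into that of a
  square matrix of full size.\<close>

definition "Z = P ** M ** W ** P + (Finite_Cartesian_Product.mat 1 - P)"

text \<open>On a kernel vector the padding forces zeros outside \<open>D_set E\<close>; inside, the
  sandwich of the symmetric part vanishes. The trace inequality then makes the symmetric part
  zero.\<close>

lemma Z_invertible: "invertible Z"
proof (rule invertible_if_ker_trivial)
  fix z assume Zz: "Z *v z = 0"
  define X where "X = unvec z"
  have z: "z = vec_of X" by (simp add: X_def)
  have Zz': "(Z *v z) $ a = (if a \<in> D_set E then (M *v (W *v (P *v z))) $ a else z $ a)" for a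
    by (simp add: Z_def matrix_vector_mult_add_rdistrib matrix_vector_mult_diff_rdistrib
        sel_mat_mult_nth flip: matrix_vector_mul_assoc)
  have X0: "X $ i $ j = 0" if "(i, j) \<notin> D_set E" for i j
    using Zz'[of "(i, j)"] that unfolding Zz by (simp add: z)
  then have "P *v z = z"
    by (auto simp: Finite_Cartesian_Product.vec_eq_iff sel_mat_mult_nth z)
  then have "M *v (W *v (P *v z)) = vec_of (I ** sym_part X ** I)"
    by (simp add: z kron_mult M_mat_mult I_transpose sym_part_sandwich)
  then have D0: "(I ** sym_part X ** I) $ i $ j = 0" if "(i, j) \<in> D_set E" for i j
    using Zz'[of "(i, j)"] that unfolding Zz by simp
  have "I ** sym_part X ** I \<in> sym_mats"
    by (intro sandwich_sym posdef_imp_sym I sym_part_sym)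
  then have D0': "(I ** sym_part X ** I) $ i $ j = 0" if "(j, i) \<in> D_set E" for i j
    using D0[OF that] by (simp add: sym_mats_nth)
  have "sym_part X $ i $ j * (I ** sym_part X ** I) $ i $ j = 0" for i j
    using D0 D0' X0 by (cases "(i, j) \<in> D_set E"; cases "(j, i) \<in> D_set E") (simp_all add: sym_part_nth)
  then have "(\<Sum>i\<in>UNIV. \<Sum>j\<in>UNIV. sym_part X $ i $ j * (I ** sym_part X ** I) $ i $ j) = 0"
    by (simp only: sum.neutral_const)
  then have H: "sym_part X = 0"
    by (rule sum_mult_sandwich_posdef_zero_imp_zero[OF I I])
  \<comment> \<open>\<open>X\<close> has at most one nonzero entry in each pair of mirrored
    positions, so a zero symmetric part leaves nothing.\<close>
  have "X $ i $ j = 0" for i j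
  proof (cases "(i, j) \<in> D_set E")
    case True
    then have "X $ j $ i = 0" by (simp add: X0 D_set_asym)
    then show ?thesis using arg_cong[OF H, of "\<lambda>B. B $ i $ j"] by (simp add: sym_part_nth)
  qed (simp add: X0)
  then show "z = 0" by (simp add: z Finite_Cartesian_Product.vec_eq_iff)
qed

text \<open>\<open>P\<close> annihilates the padding, so \<open>P ** Z\<close> and
  \<open>Z ** P\<close> both equal the compression; multiply by the inverse of
  \<open>Z\<close>.\<close>

lemma compression_inverse:
  "P ** M ** W ** P ** matrix_inv Z = P" "matrix_inv Z ** P ** M ** W ** P = P"
proof -
  note inv = matrix_inv_right_left[OF Z_invertible]
  have "P ** Z = P ** M ** W ** P"
    by (simp add: Z_def matrix_mult.add_right matrix_mult.diff_right matrix_mul_assoc sel_mat_idem)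
  then show "P ** M ** W ** P ** matrix_inv Z = P"
    by (metis inv(1) matrix_mul_assoc matrix_mul_rid)
  have "P ** M ** W ** P ** P = P ** M ** W ** P"
    by (simp add: sel_mat_idem flip: matrix_mul_assoc)
  then have "Z ** P = P ** M ** W ** P"
    by (simp add: Z_def matrix_mult.add_left matrix_mult.diff_left sel_mat_idem)
  then have "matrix_inv Z ** (P ** M ** W ** P) = P"
    by (metis inv(2) matrix_mul_assoc matrix_mul_lid)
  then show "matrix_inv Z ** P ** M ** W ** P = P"
    by (simp add: matrix_mul_assoc)
qed

end

subsection \<open>Flattened and selection matrices\<close>

lemma card_less_strict_mono: "i < j \<Longrightarrow> card {k. k < i} < card {k. k < j}"
  for i j :: "'p::{finite,linorder}"
  by (intro psubset_card_mono) auto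

lemma card_less_inj: "card {k. k < i} = card {k. k < j} \<Longrightarrow> i = j"
  for i j :: "'p::{finite,linorder}"
  by (metis card_less_strict_mono less_irrefl linorder_less_linear)

lemma card_less_bound: "card {k. k < i} < CARD('p)"
  for i :: "'p::{finite,linorder}"
  by (intro psubset_card_mono) auto

text \<open>The two summands are digits in base \<open>CARD('p)\<close>, recovered by
  \<open>div\<close> and \<open>mod\<close>; surjectivity follows by counting.\<close>

lemma vec_pos_bij: "bij_betw vec_pos (UNIV :: ('p::{finite,linorder} \<times> 'p) set) {..<CARD('p)\<^sup>2}"
proof -
  let ?p = "CARD('p)"
  have inj: "inj (vec_pos :: 'p \<times> 'p \<Rightarrow> nat)"
  proof (rule injI)
    fix a b :: "'p \<times> 'p" assume eq: "vec_pos a = vec_pos b"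
    obtain i j k l where ab: "a = (i, j)" "b = (k, l)" by (metis surj_pair)
    let ?c = "\<lambda>i::'p. card {k. k < i}"
    have eq': "?c j * ?p + ?c i = ?c l * ?p + ?c k" using eq by (simp add: vec_pos_def ab)
    have "?c j = ?c l" using arg_cong[OF eq', of "\<lambda>n. n div ?p"] card_less_bound[of i] card_less_bound[of k]
      by simp
    moreover have "?c i = ?c k" using arg_cong[OF eq', of "\<lambda>n. n mod ?p"] card_less_bound[of i] card_less_bound[of k]
      by simp
    ultimately show "a = b" using card_less_inj by (metis ab)
  qed
  have "vec_pos a < ?p\<^sup>2" for a :: "'p \<times> 'p"
  proof -
    obtain i j where a: "a = (i, j)" by (metis surj_pair)
    let ?c = "\<lambda>i::'p. card {k. k < i}"
    have "?c j * ?p + ?c i < ?c j * ?p + ?p" using card_less_bound[of i] by simp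
    also have "\<dots> = (?c j + 1) * ?p" by simp
    also have "\<dots> \<le> ?p * ?p" using card_less_bound[of j] by (intro mult_right_mono) auto
    finally show ?thesis by (simp add: vec_pos_def a power2_eq_square)
  qed
  then have "range (vec_pos :: 'p \<times> 'p \<Rightarrow> nat) \<subseteq> {..<?p\<^sup>2}" by auto
  moreover have "card (range (vec_pos :: 'p \<times> 'p \<Rightarrow> nat)) = ?p\<^sup>2"
    by (simp add: card_image inj power2_eq_square)
  ultimately have "range (vec_pos :: 'p \<times> 'p \<Rightarrow> nat) = {..<?p\<^sup>2}"
    by (intro card_subset_eq) auto
  with inj show ?thesis by (simp add: bij_betw_def)
qed

lemma vec_pos_inv [simp]: "inv_into UNIV vec_pos (vec_pos a) = a"
  using vec_pos_bij by (intro inv_into_f_f) (auto simp: bij_betw_def)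

lemma vec_pos_inv_less: "k < CARD('p)\<^sup>2 \<Longrightarrow>
    vec_pos (inv_into UNIV vec_pos k :: 'p::{finite,linorder} \<times> 'p) = k"
  using vec_pos_bij[where 'p = 'p] by (intro f_inv_into_f) (auto simp: bij_betw_def)

lemma vec_pos_inv_bij:
  "bij_betw (inv_into UNIV vec_pos) {..<CARD('p)\<^sup>2} (UNIV :: ('p::{finite,linorder} \<times> 'p) set)"
  by (rule bij_betw_inv_into[OF vec_pos_bij])

lemma dim_flat_mat [simp]:
  fixes X :: "('p::{finite,linorder} \<times> 'p) sq_mat"
  shows "dim_row (flat_mat X) = CARD('p)\<^sup>2" "dim_col (flat_mat X) = CARD('p)\<^sup>2"
  by (simp_all add: flat_mat_def)

lemma flat_mat_index [simp]:
  fixes X :: "('p::{finite,linorder} \<times> 'p) sq_mat"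
  assumes "k < CARD('p)\<^sup>2" "l < CARD('p)\<^sup>2"
  shows "flat_mat X $$ (k, l) = X $ inv_into UNIV vec_pos k $ inv_into UNIV vec_pos l"
  using assms by (simp add: flat_mat_def)

lemma flat_mat_minus: "flat_mat (X - Y) = flat_mat X - flat_mat Y"
  by (rule eq_matI) simp_all

lemma flat_mat_mult: "flat_mat (X ** Y) = flat_mat X * flat_mat Y"
proof (rule eq_matI)
  fix k l
  let ?n = "CARD('a)\<^sup>2"
  let ?\<iota> = "inv_into UNIV vec_pos :: nat \<Rightarrow> 'a \<times> 'a"
  assume "k < dim_row (flat_mat X * flat_mat Y)" "l < dim_col (flat_mat X * flat_mat Y)"
  then have kl: "k < ?n" "l < ?n" by simp_all
  have "(flat_mat X * flat_mat Y) $$ (k, l) = (\<Sum>m\<in>{..<?n}. X $ ?\<iota> k $ ?\<iota> m * Y $ ?\<iota> m $ ?\<iota> l)"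
    using kl by (simp add: scalar_prod_def lessThan_atLeast0)
  also have "\<dots> = (\<Sum>c\<in>UNIV. X $ ?\<iota> k $ c * Y $ c $ ?\<iota> l)"
    by (rule sum.reindex_bij_betw[OF vec_pos_inv_bij])
  finally show "flat_mat (X ** Y) $$ (k, l) = (flat_mat X * flat_mat Y) $$ (k, l)"
    using kl by (simp add: matrix_matrix_mult_def)
qed simp_all

lemma dim_Q_mat [simp]:
  fixes Z :: "('p::{finite,linorder} \<times> 'p) set"
  shows "dim_row (Q_mat Z) = card Z" "dim_col (Q_mat Z) = CARD('p)\<^sup>2"
  by (simp_all add: Q_mat_def)

text \<open>The rows are distinct unit vectors because the sorted list has no repetitions.\<close>

lemma Q_mat_mult_transpose: "Q_mat Z * transpose_mat (Q_mat Z) = 1\<^sub>m (card Z)"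
  for Z :: "('p::{finite,linorder} \<times> 'p) set"
proof (rule eq_matI)
  let ?s = "\<lambda>k. sorted_list_of_set (vec_pos ` Z) ! k"
  let ?n = "CARD('p)\<^sup>2"
  have len: "length (sorted_list_of_set (vec_pos ` Z)) = card Z"
    using vec_pos_bij[where 'p = 'p]
    by (auto simp: bij_betw_def intro!: card_image intro: inj_on_subset)
  fix k l assume "k < dim_row (1\<^sub>m (card Z))" "l < dim_col (1\<^sub>m (card Z))"
  then have kl: "k < card Z" "l < card Z" by simp_all
  have "?s k \<in> set (sorted_list_of_set (vec_pos ` Z))"
    using kl len by (intro nth_mem) simp
  then have "?s k \<in> vec_pos ` Z" by simp
  then have sk: "?s k < ?n" using vec_pos_bij[where 'p = 'p] by (auto simp: bij_betw_def)
  have "(Q_mat Z * transpose_mat (Q_mat Z)) $$ (k, l)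
      = (\<Sum>m\<in>{..<?n}. (if m = ?s k then 1 else 0) * (if m = ?s l then 1 else 0))"
    using kl by (simp add: Q_mat_def scalar_prod_def lessThan_atLeast0)
  also have "\<dots> = (\<Sum>m\<in>{..<?n}. if m = ?s k then (if ?s k = ?s l then 1 else 0) else 0)"
    by (intro sum.cong) auto
  also have "\<dots> = (if ?s k = ?s l then 1 else 0)" using sk by simp
  also have "\<dots> = 1\<^sub>m (card Z) $$ (k, l)"
    using kl len by (subst nth_eq_iff_index_eq) simp_all
  finally show "(Q_mat Z * transpose_mat (Q_mat Z)) $$ (k, l) = 1\<^sub>m (card Z) $$ (k, l)" .
qed simp_all

text \<open>The entry at \<open>(k, l)\<close> counts the rows that select both \<open>k\<close> and
  \<open>l\<close>.\<close>

lemma transpose_Q_mat_mult: "transpose_mat (Q_mat Z) * Q_mat Z = flat_mat (sel_mat Z)"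
  for Z :: "('p::{finite,linorder} \<times> 'p) set"
proof (rule eq_matI)
  let ?xs = "sorted_list_of_set (vec_pos ` Z)"
  let ?n = "CARD('p)\<^sup>2"
  let ?\<iota> = "inv_into UNIV vec_pos :: nat \<Rightarrow> 'p \<times> 'p"
  have len: "length ?xs = card Z"
    using vec_pos_bij[where 'p = 'p]
    by (auto simp: bij_betw_def intro!: card_image intro: inj_on_subset)
  fix k l assume "k < dim_row (flat_mat (sel_mat Z))" "l < dim_col (flat_mat (sel_mat Z))"
  then have kl: "k < ?n" "l < ?n" by simp_all
  have mem: "k \<in> vec_pos ` Z \<longleftrightarrow> ?\<iota> k \<in> Z"
    using kl(1) by (metis image_iff vec_pos_inv vec_pos_inv_less)
  have eq: "?\<iota> k = ?\<iota> l \<longleftrightarrow> k = l" using kl by (metis vec_pos_inv_less)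
  have "(transpose_mat (Q_mat Z) * Q_mat Z) $$ (k, l)
      = (\<Sum>m\<in>{..<card Z}. (if k = ?xs ! m then 1 else 0) * (if l = ?xs ! m then 1 else 0))"
    using kl by (simp add: Q_mat_def scalar_prod_def lessThan_atLeast0)
  also have "\<dots> = (\<Sum>m\<in>{..<length ?xs}. (if k = ?xs ! m \<and> k = l then 1 else 0))"
    unfolding len by (intro sum.cong) auto
  also have "\<dots> = (\<Sum>x\<in>set ?xs. (if k = x \<and> k = l then 1 else 0))"
    by (intro sum.reindex_bij_betw bij_betw_nth) auto
  also have "\<dots> = (if k \<in> vec_pos ` Z \<and> k = l then 1 else 0)"
    by (cases "k = l") simp_all
  also have "\<dots> = flat_mat (sel_mat Z) $$ (k, l)"
    using kl mem eq by (cases "k = l") (simp_all add: sel_mat_def)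
  finally show "(transpose_mat (Q_mat Z) * Q_mat Z) $$ (k, l) = flat_mat (sel_mat Z) $$ (k, l)" .
qed simp_all

text \<open>With equations between dimensions as premises, associativity becomes a conditional
  rewrite rule for long products.\<close>

lemma mult_mat_assoc_dim:
  fixes A B C :: "'a::semiring_0 mat"
  assumes "dim_col A = dim_row B" "dim_col B = dim_row C"
  shows "A * B * C = A * (B * C)"
  using assms by (intro assoc_mult_mat[OF carrier_matI carrier_matI carrier_matI]) auto

text \<open>A two-sided inverse makes \<open>S\<close> a unit of the matrix ring, so
  \<open>mat_inverse\<close> returns a value. The case \<open>n = 0\<close> is covered, hence a
  graph without missing edges needs no separate treatment.\<close>

lemma mat_inverse_the:
  fixes S B :: "'a::field mat"
  assumes "S \<in> carrier_mat n n" "B \<in> carrier_mat n n" "S * B = 1\<^sub>m n" "B * S = 1\<^sub>m n"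
  shows "the (mat_inverse S) * S = 1\<^sub>m n" "the (mat_inverse S) \<in> carrier_mat n n"
proof -
  have "S \<in> Units (ring_mat TYPE('a) n ())"
    using assms by (auto simp: Units_def ring_mat_def)
  then obtain C where "mat_inverse S = Some C"
    using mat_inverse(1)[OF assms(1), where b = "()"] by (cases "mat_inverse S") auto
  with mat_inverse(2)[OF assms(1) this]
  show "the (mat_inverse S) * S = 1\<^sub>m n" "the (mat_inverse S) \<in> carrier_mat n n"
    by auto
qed

section \<open>Assembly of the derivative formula\<close>

theorem proposition1:
  fixes E :: "'p::{finite,linorder} set set"
  assumes "E \<subseteq> {{i, j} | i j. i \<noteq> j}"
  shows "cont_differentiable_on (h_G E) posdef_mats \<and>
    (\<forall>A \<in> posdef_mats.
      let M = flat_mat (M_mat :: ('p \<times> 'p) sq_mat);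
          Q = Q_D E;
          W = flat_mat (kron (matrix_inv (h_G E A)) (matrix_inv (h_G E A)));
          S = Q * M * W * transpose_mat Q
      in invertible_mat S \<and>
         flat_mat (matrix_deriv posdef_mats (h_G E) A) =
           M - M * transpose_mat Q * the (mat_inverse S) * Q * W * M)"
proof (intro conjI ballI)
  show "cont_differentiable_on (h_G E) posdef_mats" by (rule cont_differentiable_on_h_G)
  fix A :: "'p sq_mat" assume A: "A \<in> posdef_mats"
  interpret completion_derivative E A by standard (rule A)
  let ?n = "CARD('p)\<^sup>2" and ?r = "card (D_set E)"
  define m where "m = flat_mat M"
  define w where "w = flat_mat W"
  define q where "q = Q_D E"
  define qt where "qt = transpose_mat q"
  define S where "S = q * m * w * qt"
  \<comment> \<open>The candidate inverse of \<open>S\<close>: the inverse of the padded matrix,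
    compressed to the selected positions.\<close>
  define B where "B = q * flat_mat (matrix_inv Z) * qt"
  have dims [simp]: "dim_row m = ?n" "dim_col m = ?n" "dim_row w = ?n" "dim_col w = ?n"
    "dim_row q = ?r" "dim_col q = ?n" "dim_row qt = ?n" "dim_col qt = ?r"
    by (simp_all add: m_def w_def q_def qt_def Q_D_def)
  have dimS [simp]: "dim_row S = ?r" "dim_col S = ?r" "dim_row B = ?r" "dim_col B = ?r"
    by (simp_all add: S_def B_def)
  have qqt: "q * qt = 1\<^sub>m ?r"
    by (simp add: q_def qt_def Q_D_def Q_mat_mult_transpose)
  have qtq: "qt * q = flat_mat P"
    by (simp add: q_def qt_def Q_D_def transpose_Q_mat_mult)
  \<comment> \<open>Together with associativity to the right these two rules normalise products: Q
    Q^T disappears and \<open>P\<close> is split into Q^T Q.\<close>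
  have cancel: "q * (qt * Y) = Y" if "dim_row Y = ?r" for Y
    using that by (simp add: qqt flip: mult_mat_assoc_dim)
  have flatP: "flat_mat P * Y = qt * (q * Y)" if "dim_row Y = ?n" for Y
    using that by (simp add: mult_mat_assoc_dim flip: qtq)
  have "S * B = q * (flat_mat (P ** M ** W ** P ** matrix_inv Z) * qt)"
    by (simp add: S_def B_def flat_mat_mult mult_mat_assoc_dim flatP cancel flip: m_def w_def)
  then have SB: "S * B = 1\<^sub>m ?r"
    unfolding compression_inverse by (simp add: flatP cancel qqt)
  have "B * S = q * (flat_mat (matrix_inv Z ** P ** M ** W ** P) * qt)"
    by (simp add: S_def B_def flat_mat_mult mult_mat_assoc_dim flatP cancel qqt flip: m_def w_def)
  then have BS: "B * S = 1\<^sub>m ?r"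
    unfolding compression_inverse by (simp add: flatP cancel qqt)
  have SC: "S \<in> carrier_mat ?r ?r" "B \<in> carrier_mat ?r ?r" by auto
  have "invertible_mat S"
    unfolding invertible_mat_def inverts_mat_def using SB BS by auto
  note inv = mat_inverse_the[OF SC SB BS]
  have dimI [simp]: "dim_row (the (mat_inverse S)) = ?r" "dim_col (the (mat_inverse S)) = ?r"
    using inv(2) by auto
  \<comment> \<open>The unknown of the linear system with matrix \<open>S\<close> will be
    \<open>q * g\<close>.\<close>
  define g where "g = flat_mat (2 *\<^sub>R (M - F))"
  have dimg [simp]: "dim_row g = ?n" "dim_col g = ?n" by (simp_all add: g_def)
  have corr: "flat_mat (M - F) = m * (qt * (q * g))"
    by (subst derivative_correction)
      (simp add: flat_mat_mult mult_mat_assoc_dim flatP m_def[symmetric] g_def[symmetric])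
  \<comment> \<open>Inserting the corrected form of \<open>M - F\<close> here yields the linear
    system for \<open>q * g\<close>.\<close>
  have "P ** W ** (M - F) = P ** W ** M"
    by (simp add: matrix_mult.diff_right derivative_orthogonality)
  from arg_cong[OF this, of flat_mat]
  have "qt * (q * (w * (m * (qt * (q * g))))) = qt * (q * (w * m))"
    by (simp add: flat_mat_mult mult_mat_assoc_dim flatP corr flip: m_def w_def)
  from arg_cong[OF this, of "\<lambda>X. q * X"]
  have qw: "q * (w * (m * (qt * (q * g)))) = q * (w * m)"
    by (simp add: cancel)
  \<comment> \<open>The system arises with the factors in the order \<open>w * m\<close>, whereas
    \<open>S\<close> contains \<open>m * w\<close>.\<close>
  have wm: "w * m = m * w"
    using arg_cong[OF M_mat_kron_commute[OF I_transpose], of flat_mat]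
    by (simp add: flat_mat_mult m_def w_def)
  have "S * (q * g) = q * (w * m)"
  proof -
    have "S * (q * g) = q * ((m * w) * (qt * (q * g)))"
      by (simp add: S_def mult_mat_assoc_dim)
    also have "\<dots> = q * (w * (m * (qt * (q * g))))"
      by (simp add: mult_mat_assoc_dim flip: wm)
    finally show ?thesis by (simp add: qw)
  qed
  then have "the (mat_inverse S) * S * (q * g) = the (mat_inverse S) * (q * (w * m))"
    by (simp add: mult_mat_assoc_dim)
  then have "q * g = the (mat_inverse S) * (q * (w * m))"
    by (simp add: inv(1))
  then have MF: "flat_mat (M - F) = m * qt * the (mat_inverse S) * q * w * m"
    by (simp add: corr mult_mat_assoc_dim)
  have "flat_mat F = flat_mat (M - (M - F))" by simp
  also have "\<dots> = m - m * qt * the (mat_inverse S) * q * w * m"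
    by (simp only: flat_mat_minus[of M "M - F"] MF flip: m_def)
  finally have "flat_mat F = m - m * qt * the (mat_inverse S) * q * w * m" .
  with \<open>invertible_mat S\<close>
  show "let M = flat_mat (M_mat :: ('p \<times> 'p) sq_mat); Q = Q_D E; W = flat_mat (kron I I);
      S = Q * M * W * transpose_mat Q
    in invertible_mat S \<and> flat_mat F = M - M * transpose_mat Q * the (mat_inverse S) * Q * W * M"
    by (simp only: Let_def S_def m_def w_def q_def qt_def)
qed

end
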